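(* Let $n\geq 2$ and $m$ be integers, and let $H_{n,m}=\langle x,y\mid x^n=1,\ y^2=x^m,\ yx=x^{-1}y\rangle$. Then $$\mathfrak{g}(H_{n,m})=\begin{cases}2n+1, & n \text{ odd},\\ 2n, & n\equiv 0 \pmod 4,\ m \text{ odd},\\ 2n+1, & n\equiv 2\pmod 4,\ m\text{ odd},\\ n+2, & n \text{ even},\ n\neq 2,\ m \text{ even},\\ 5, & n=2,\ m\text{ even}.\end{cases}$$
   Context: $H_{n,m}$ is the group of order $2n$ with the given presentation; its elements are $1,x,\dots,x^{n-1},y,xy,\dots,x^{n-1}y$. For a finite group $G$, $\exp(G)$ is the least common multiple of the orders of its elements. The Harborth constant $\mathfrak{g}(G)$ is the smallest integer $k\geq \exp(G)$ such that every subset of $G$ of size $k$ contains $\exp(G)$ distinct elements whose product (in some order) is $1$; if no such $k\leq |G|$ exists, $\mathfrak{g}(G)=|G|+1$.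
   Formalization: The presentation forces x^{2m}=1, so H_{n,m} has order 2n only if n divides 2m; the theorem assumes order 2n. For other m the formula fails (n=4, m=1 gives a cyclic group of order 4 with constant 5, not 8), and the case n≡0 mod 4, m odd is vacuous. *)

theory Defs
  imports "HOL-Algebra.Multiplicative_Group"
begin

section \<open>Groups given by generators and relations\<close>

text \<open>
  A letter is a generator \<open>g\<close>, encoded as \<open>(g, True)\<close>, or its formal inverse \<open>(g, False)\<close>.
  A relation is a pair \<open>(u, v)\<close> of words, read as the equation \<open>u = v\<close>.
\<close>

type_synonym 'g word = "('g \<times> bool) list"

inductive pres_eq :: "('g word \<times> 'g word) set \<Rightarrow> 'g word \<Rightarrow> 'g word \<Rightarrow> bool"
  for R :: "('g word \<times> 'g word) set"
where
  pres_refl: "pres_eq R u u"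
| pres_sym: "pres_eq R u v \<Longrightarrow> pres_eq R v u"
| pres_trans: "pres_eq R u v \<Longrightarrow> pres_eq R v w \<Longrightarrow> pres_eq R u w"
| pres_cancel: "pres_eq R (a @ [(g, s), (g, \<not> s)] @ b) (a @ b)"
| pres_rel: "(u, v) \<in> R \<Longrightarrow> pres_eq R (a @ u @ b) (a @ v @ b)"

definition pres_class :: "('g word \<times> 'g word) set \<Rightarrow> 'g word \<Rightarrow> 'g word set" where
  "pres_class R u = {v. pres_eq R u v}"

text \<open>The generators are all elements of the type \<open>'g\<close>.\<close>

definition presented_group :: "('g word \<times> 'g word) set \<Rightarrow> 'g word set monoid" where
  "presented_group R =
     \<lparr>carrier = range (pres_class R),
      mult = (\<lambda>A B. \<Union>u\<in>A. \<Union>v\<in>B. pres_class R (u @ v)),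
      one = pres_class R []\<rparr>"

lemma pres_eq_append:
  assumes "pres_eq R u u'" "pres_eq R v v'"
  shows "pres_eq R (u @ v) (u' @ v')"
proof -
  have ctx: "pres_eq R (a @ p @ b) (a @ q @ b)" if "pres_eq R p q" for p q a b
    using that
  proof (induction rule: pres_eq.induct)
    case (pres_cancel c g s d)
    show ?case using pres_eq.pres_cancel[of R "a @ c" g s "d @ b"] by simp
  next
    case (pres_rel p q c d)
    then show ?case using pres_eq.pres_rel[of p q R "a @ c" "d @ b"] by simp
  qed (blast intro: pres_eq.intros)+
  have "pres_eq R (u @ v) (u' @ v)" using ctx[OF assms(1), of "[]" v] by simp
  moreover have "pres_eq R (u' @ v) (u' @ v')" using ctx[OF assms(2), of u' "[]"] by simp
  ultimately show ?thesis by (rule pres_trans)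
qed

lemma pres_class_eq_iff: "pres_class R u = pres_class R v \<longleftrightarrow> pres_eq R u v"
  unfolding pres_class_def by (blast intro: pres_refl pres_sym pres_trans)

lemma presented_group_mult:
  "pres_class R u \<otimes>\<^bsub>presented_group R\<^esub> pres_class R v = pres_class R (u @ v)"
proof -
  have eq: "pres_class R (p @ q) = pres_class R (u @ v)"
    if "p \<in> pres_class R u" "q \<in> pres_class R v" for p q
  proof -
    have "pres_eq R u p" "pres_eq R v q" using that by (simp_all add: pres_class_def)
    then show ?thesis unfolding pres_class_eq_iff by (rule pres_sym[OF pres_eq_append])
  qed
  have "u \<in> pres_class R u" "v \<in> pres_class R v"
    by (simp_all add: pres_class_def pres_refl)
  with eq have "(\<Union>p\<in>pres_class R u. \<Union>q\<in>pres_class R v. pres_class R (p @ q)) =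
      pres_class R (u @ v)"
    by blast
  then show ?thesis by (simp add: presented_group_def)
qed

definition word_inv :: "'g word \<Rightarrow> 'g word" where
  "word_inv w = rev (map (\<lambda>(g, s). (g, \<not> s)) w)"

lemma pres_eq_word_inv: "pres_eq R (word_inv w @ w) []"
proof (induction w)
  case Nil
  then show ?case by (simp add: word_inv_def pres_refl)
next
  case (Cons l w)
  obtain g s where l: "l = (g, s)" by fastforce
  have "pres_eq R (word_inv w @ [(g, \<not> s), (g, \<not> \<not> s)] @ w) (word_inv w @ w)"
    by (rule pres_cancel)
  then have "pres_eq R (word_inv (l # w) @ l # w) (word_inv w @ w)"
    by (simp add: l word_inv_def)
  then show ?case using Cons.IH by (rule pres_trans)
qed

lemma presented_group_carrier: "carrier (presented_group R) = range (pres_class R)"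
  by (simp add: presented_group_def)

lemma presented_group_one: "\<one>\<^bsub>presented_group R\<^esub> = pres_class R []"
  by (simp add: presented_group_def)

lemma group_presented_group: "group (presented_group R)"
proof (rule groupI)
  show "\<one>\<^bsub>presented_group R\<^esub> \<in> carrier (presented_group R)"
    by (simp add: presented_group_one presented_group_carrier)
next
  fix A B assume "A \<in> carrier (presented_group R)" "B \<in> carrier (presented_group R)"
  then obtain u v where "A = pres_class R u" "B = pres_class R v"
    by (auto simp: presented_group_carrier)
  then show "A \<otimes>\<^bsub>presented_group R\<^esub> B \<in> carrier (presented_group R)"
    by (simp add: presented_group_mult presented_group_carrier)
next
  fix A B C
  assume "A \<in> carrier (presented_group R)" "B \<in> carrier (presented_group R)"
    "C \<in> carrier (presented_group R)"
  then obtain u v w where "A = pres_class R u" "B = pres_class R v" "C = pres_class R w"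
    by (auto simp: presented_group_carrier)
  then show "A \<otimes>\<^bsub>presented_group R\<^esub> B \<otimes>\<^bsub>presented_group R\<^esub> C =
      A \<otimes>\<^bsub>presented_group R\<^esub> (B \<otimes>\<^bsub>presented_group R\<^esub> C)"
    by (simp add: presented_group_mult)
next
  fix A assume "A \<in> carrier (presented_group R)"
  then obtain u where A: "A = pres_class R u" by (auto simp: presented_group_carrier)
  then show "\<one>\<^bsub>presented_group R\<^esub> \<otimes>\<^bsub>presented_group R\<^esub> A = A"
    by (simp add: presented_group_one presented_group_mult)
  have "pres_class R (word_inv u) \<otimes>\<^bsub>presented_group R\<^esub> A = \<one>\<^bsub>presented_group R\<^esub>"
    by (simp add: presented_group_one A presented_group_mult pres_class_eq_iff pres_eq_word_inv)
  moreover have "pres_class R (word_inv u) \<in> carrier (presented_group R)"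
    by (simp add: presented_group_carrier)
  ultimately show "\<exists>B\<in>carrier (presented_group R).
      B \<otimes>\<^bsub>presented_group R\<^esub> A = \<one>\<^bsub>presented_group R\<^esub>"
    by blast
qed


section \<open>The groups \<open>H\<^sub>n\<^sub>,\<^sub>m\<close>\<close>

datatype gen = X | Y

definition gen_pow :: "'g \<Rightarrow> int \<Rightarrow> 'g word" where
  "gen_pow g k = replicate (nat \<bar>k\<bar>) (g, 0 \<le> k)"

definition H_rels :: "nat \<Rightarrow> int \<Rightarrow> (gen word \<times> gen word) set" where
  "H_rels n m =
     {(gen_pow X (int n), []),
      (gen_pow Y 2, gen_pow X m),
      (gen_pow Y 1 @ gen_pow X 1, gen_pow X (- 1) @ gen_pow Y 1)}"

definition H :: "nat \<Rightarrow> int \<Rightarrow> gen word set monoid" where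
  "H n m = presented_group (H_rels n m)"

lemma group_H: "group (H n m)"
  unfolding H_def by (rule group_presented_group)


section \<open>The Harborth constant\<close>

definition group_exp :: "('a, 'b) monoid_scheme \<Rightarrow> nat" where
  "group_exp G = Lcm (group.ord G ` carrier G)"

definition harborth_property :: "('a, 'b) monoid_scheme \<Rightarrow> nat \<Rightarrow> bool" where
  "harborth_property G k \<longleftrightarrow>
     (\<forall>A. A \<subseteq> carrier G \<and> card A = k \<longrightarrow>
        (\<exists>xs. distinct xs \<and> set xs \<subseteq> A \<and> length xs = group_exp G \<and>
              foldr (\<otimes>\<^bsub>G\<^esub>) xs \<one>\<^bsub>G\<^esub> = \<one>\<^bsub>G\<^esub>))"

definition harborth :: "('a, 'b) monoid_scheme \<Rightarrow> nat" where
  "harborth G =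
     (if \<exists>k. group_exp G \<le> k \<and> k \<le> order G \<and> harborth_property G k
      then LEAST k. group_exp G \<le> k \<and> harborth_property G k
      else order G + 1)"


section \<open>When \<open>H\<^sub>n\<^sub>,\<^sub>m\<close> has order \<open>2n\<close>\<close>

text \<open>
  The relations force \<open>x\<^sup>2\<^sup>m = 1\<close>, so the presented group has order \<open>2n\<close>, with elements
  \<open>1, x, \<dots>, x\<^sup>n\<^sup>-\<^sup>1, y, xy, \<dots>, x\<^sup>n\<^sup>-\<^sup>1y\<close> pairwise distinct, exactly when \<open>n\<close> divides \<open>2m\<close>; otherwise it
  is smaller. For the proof, \<open>H_act\<close> is right multiplication by a letter on the
  normal forms \<open>x\<^sup>a y\<^sup>s\<close>, written as pairs \<open>(a, s)\<close>.
\<close>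

fun H_act :: "int \<Rightarrow> gen \<times> bool \<Rightarrow> int \<times> bool \<Rightarrow> int \<times> bool" where
  "H_act m (X, e) (a, s) = (if e = s then a - 1 else a + 1, s)"
| "H_act m (Y, e) (a, s) = (if e \<and> s then a + m else if \<not> e \<and> \<not> s then a - m else a, \<not> s)"

definition H_sim :: "nat \<Rightarrow> int \<times> bool \<Rightarrow> int \<times> bool \<Rightarrow> bool" where
  "H_sim n p q \<longleftrightarrow> snd p = snd q \<and> int n dvd (fst p - fst q)"

lemma sim_act: "H_sim n p q \<Longrightarrow> H_sim n (H_act m l p) (H_act m l q)"
proof -
  assume a: "H_sim n p q"
  obtain i s j where p: "p = (i, s)" and q: "q = (j, s)" using a by (cases p; cases q) (simp add: H_sim_def)
  obtain g e where l: "l = (g, e)" by fastforce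
  from a show ?thesis unfolding p q l
    by (cases g; cases e; cases s) (simp_all add: H_sim_def)
qed

lemma sim_fold: "H_sim n p q \<Longrightarrow> H_sim n (fold (H_act m) w p) (fold (H_act m) w q)"
proof (induction w arbitrary: p q)
  case (Cons l w)
  show ?case using Cons.IH[OF sim_act[OF Cons.prems]] by simp
qed simp

lemma sim_refl: "H_sim n p p" by (simp add: H_sim_def)
lemma sim_sym: "H_sim n p q \<Longrightarrow> H_sim n q p" by (auto simp: H_sim_def dvd_diff_commute)
lemma sim_trans: "H_sim n p q \<Longrightarrow> H_sim n q r \<Longrightarrow> H_sim n p r"
  unfolding H_sim_def using dvd_add[of "int n" "fst p - fst q" "fst q - fst r"] by auto

lemma act_rep: "fold (H_act m) (replicate k (X, e)) (a, s) = (if e = s then a - int k else a + int k, s)"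
  by (induction k arbitrary: a) (auto simp del: fold_replicate)

lemma act_gen_pow: "fold (H_act m) (gen_pow X k) (a, s) = (if s then a - k else a + k, s)"
  unfolding gen_pow_def act_rep by auto

lemma act_rel:
  assumes "(u, v) \<in> H_rels n m" "int n dvd 2 * m"
  shows "H_sim n (fold (H_act m) u p) (fold (H_act m) v p)"
proof -
  obtain a s where p: "p = (a, s)" by fastforce
  from assms(1) consider "u = gen_pow X (int n)" "v = []"
    | "u = [(Y, True), (Y, True)]" "v = gen_pow X m"
    | "u = [(Y, True), (X, True)]" "v = [(X, False), (Y, True)]"
    by (auto simp: H_rels_def gen_pow_def numeral_2_eq_2)
  then show ?thesis
  proof cases
    case 2
    have "a + m - (a - m) = 2 * m" by simp
    then have "int n dvd a + m - (a - m)" using assms(2) by simp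
    then show ?thesis using 2 by (simp add: p act_gen_pow H_sim_def)
  qed (simp_all add: p act_gen_pow H_sim_def)
qed

lemma act_pres:
  assumes "int n dvd 2 * m" "pres_eq (H_rels n m) u v"
  shows "H_sim n (fold (H_act m) u p) (fold (H_act m) v p)"
  using assms(2)
proof (induction arbitrary: p rule: pres_eq.induct)
  case (pres_cancel a g s b)
  have "fold (H_act m) [(g, s), (g, \<not> s)] q = q" for q
    by (cases q; cases g) auto
  then show ?case by (simp add: sim_refl)
next
  case (pres_rel u v a b)
  show ?case using sim_fold[OF act_rel[OF pres_rel assms(1)]] by simp
qed (blast intro: sim_refl sim_sym sim_trans)+

lemma pres_class_gen_pow:
  "pres_class R (gen_pow g k) = pres_class R [(g, True)] [^]\<^bsub>presented_group R\<^esub> (k::int)"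
proof -
  interpret group "presented_group R" by (rule group_presented_group)
  let ?x = "pres_class R [(g, True)]"
  have x: "?x \<in> carrier (presented_group R)" by (simp add: presented_group_carrier)
  have x': "pres_class R [(g, False)] \<in> carrier (presented_group R)"
    by (simp add: presented_group_carrier)
  have "pres_class R [(g, False)] \<otimes>\<^bsub>presented_group R\<^esub> ?x = \<one>\<^bsub>presented_group R\<^esub>"
    using pres_cancel[of R "[]" g False "[]"]
    by (simp add: presented_group_mult presented_group_one pres_class_eq_iff)
  then have inv: "pres_class R [(g, False)] = inv\<^bsub>presented_group R\<^esub> ?x"
    using x x' by (simp add: inv_equality)
  have rep: "pres_class R (replicate i l) = pres_class R [l] [^]\<^bsub>presented_group R\<^esub> i" for i l
  proof (induction i)
    case (Suc i)
    have "pres_class R (replicate (Suc i) l) = pres_class R (replicate i l @ [l])"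
      by (simp add: replicate_append_same)
    then show ?case using Suc by (simp flip: presented_group_mult)
  qed (simp add: presented_group_one)
  show ?thesis
  proof (cases "0 \<le> k")
    case True
    then have "gen_pow g k = replicate (nat k) (g, True)" by (simp add: gen_pow_def)
    moreover have "?x [^]\<^bsub>presented_group R\<^esub> k = ?x [^]\<^bsub>presented_group R\<^esub> nat k"
      using True by (simp only: pow_nat)
    ultimately show ?thesis by (simp only: rep)
  next
    case False
    then have "gen_pow g k = replicate (nat (- k)) (g, False)" by (simp add: gen_pow_def)
    moreover have "?x [^]\<^bsub>presented_group R\<^esub> k =
        inv\<^bsub>presented_group R\<^esub> (?x [^]\<^bsub>presented_group R\<^esub> nat (- k))"
      using False by (simp only: int_pow_def2 not_le if_True)
    ultimately show ?thesis using x by (simp only: rep inv nat_pow_inv)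
  qed
qed

lemma order_H_iff:
  assumes "n \<ge> 1"
  shows "order (H n m) = 2 * n \<longleftrightarrow> int n dvd 2 * m"
proof -
  define G where "G = H n m"
  define cl where "cl = pres_class (H_rels n m)"
  define x where "x = cl [(X, True)]"
  define y where "y = cl [(Y, True)]"
  interpret group G unfolding G_def by (rule group_H)
  have mult: "cl u \<otimes>\<^bsub>G\<^esub> cl v = cl (u @ v)" for u v
    by (simp add: G_def H_def cl_def presented_group_mult)
  have car: "carrier G = range cl" by (simp add: G_def H_def cl_def presented_group_carrier)
  have [simp]: "x \<in> carrier G" "y \<in> carrier G" by (auto simp: x_def y_def car)
  have gp: "cl (gen_pow X k) = x [^]\<^bsub>G\<^esub> k" "cl (gen_pow Y k) = y [^]\<^bsub>G\<^esub> k" for k :: int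
    by (simp_all add: G_def H_def cl_def x_def y_def pres_class_gen_pow)
  have rel: "cl u = cl v" if "(u, v) \<in> H_rels n m" for u v
    using pres_rel[OF that, of "[]" "[]"] by (simp add: cl_def pres_class_eq_iff)
  have one: "\<one>\<^bsub>G\<^esub> = cl []" by (simp add: G_def H_def cl_def presented_group_one)
  have xn: "x [^]\<^bsub>G\<^esub> (int n) = \<one>\<^bsub>G\<^esub>"
    using rel[of "gen_pow X (int n)" "[]"] by (simp add: H_rels_def gp one)
  have yy: "y \<otimes>\<^bsub>G\<^esub> y = x [^]\<^bsub>G\<^esub> m"
    using rel[of "gen_pow Y 2" "gen_pow X m"] int_pow_mult[of y 1 1]
    by (simp add: H_rels_def gp)
  have yx: "y \<otimes>\<^bsub>G\<^esub> x = inv\<^bsub>G\<^esub> x \<otimes>\<^bsub>G\<^esub> y"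
    using rel[of "gen_pow Y 1 @ gen_pow X 1" "gen_pow X (- 1) @ gen_pow Y 1"]
    by (simp add: H_rels_def gp int_pow_neg flip: mult)
  have "y \<otimes>\<^bsub>G\<^esub> x \<otimes>\<^bsub>G\<^esub> inv\<^bsub>G\<^esub> y = inv\<^bsub>G\<^esub> x" by (simp add: yx inv_solve_right')
  have yxn: "y \<otimes>\<^bsub>G\<^esub> x [^]\<^bsub>G\<^esub> i = inv\<^bsub>G\<^esub> x [^]\<^bsub>G\<^esub> i \<otimes>\<^bsub>G\<^esub> y" for i :: nat
  proof (induction i)
    case (Suc i)
    have "y \<otimes>\<^bsub>G\<^esub> x [^]\<^bsub>G\<^esub> Suc i = y \<otimes>\<^bsub>G\<^esub> x [^]\<^bsub>G\<^esub> i \<otimes>\<^bsub>G\<^esub> x" by (simp add: m_assoc)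
    also have "\<dots> = inv\<^bsub>G\<^esub> x [^]\<^bsub>G\<^esub> i \<otimes>\<^bsub>G\<^esub> (y \<otimes>\<^bsub>G\<^esub> x)" by (simp add: Suc m_assoc)
    also have "\<dots> = inv\<^bsub>G\<^esub> x [^]\<^bsub>G\<^esub> Suc i \<otimes>\<^bsub>G\<^esub> y" by (simp add: yx m_assoc)
    finally show ?case .
  qed simp
  have yxk: "y \<otimes>\<^bsub>G\<^esub> x [^]\<^bsub>G\<^esub> k = x [^]\<^bsub>G\<^esub> (- k) \<otimes>\<^bsub>G\<^esub> y" for k :: int
  proof -
    have "int n > 0" using assms by simp
    then have "k mod int n = int (nat (k mod int n))" by simp
    then obtain i where i: "k mod int n = int i" by blast
    have "int (ord x) dvd int n" using xn by (simp add: int_pow_eq_id)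
    then have d: "int (ord x) dvd (int i - k)"
      using i by (metis dvd_trans mod_eq_dvd_iff mod_mod_trivial)
    have "x [^]\<^bsub>G\<^esub> k = x [^]\<^bsub>G\<^esub> i" using d by (simp add: int_pow_eq flip: int_pow_int)
    then show ?thesis
      by (simp add: yxn int_pow_neg nat_pow_inv)
  qed
  have x2m: "int (ord x) dvd 2 * m"
  proof -
    have "y \<otimes>\<^bsub>G\<^esub> x [^]\<^bsub>G\<^esub> m = x [^]\<^bsub>G\<^esub> m \<otimes>\<^bsub>G\<^esub> y" by (simp add: m_assoc flip: yy)
    then have "x [^]\<^bsub>G\<^esub> m = x [^]\<^bsub>G\<^esub> (- m)" by (simp add: yxk)
    then have "int (ord x) dvd - m - m" by (simp add: int_pow_eq)
    moreover have "- m - m = - (2 * m)" by simp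
    ultimately show ?thesis by (simp only: dvd_minus_iff)
  qed
  have xdn: "ord x dvd n" using xn by (simp add: int_pow_eq_id)
  define f where "f = (\<lambda>(i::nat, s). if s then x [^]\<^bsub>G\<^esub> i \<otimes>\<^bsub>G\<^esub> y else x [^]\<^bsub>G\<^esub> i)"
  have ox: "ord x > 0" using xdn assms by (metis dvd_0_left gr0I not_one_le_zero)
  have nfk: "\<exists>i<ord x. x [^]\<^bsub>G\<^esub> k = x [^]\<^bsub>G\<^esub> i" for k :: int
  proof (intro exI conjI)
    show "nat (k mod int (ord x)) < ord x" using ox by (simp add: nat_less_iff)
    have "int (nat (k mod int (ord x))) = k mod int (ord x)" using ox by simp
    moreover have "int (ord x) dvd k mod int (ord x) - k"
      by (metis mod_eq_dvd_iff mod_mod_trivial)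
    ultimately have "x [^]\<^bsub>G\<^esub> k = x [^]\<^bsub>G\<^esub> (int (nat (k mod int (ord x))))"
      by (simp add: int_pow_eq)
    then show "x [^]\<^bsub>G\<^esub> k = x [^]\<^bsub>G\<^esub> nat (k mod int (ord x))" by (simp only: int_pow_int)
  qed
  have xi: "cl [(X, False)] = x [^]\<^bsub>G\<^esub> (- 1 :: int)"
    using gp(1)[of "-1"] by (simp add: gen_pow_def)
  have xi1: "cl [(X, True)] = x [^]\<^bsub>G\<^esub> (1 :: int)"
    by (simp add: x_def[symmetric])
  have "y \<otimes>\<^bsub>G\<^esub> (x [^]\<^bsub>G\<^esub> m) = (x [^]\<^bsub>G\<^esub> m) \<otimes>\<^bsub>G\<^esub> y" by (simp add: m_assoc flip: yy)
  have "(x [^]\<^bsub>G\<^esub> (-m) \<otimes>\<^bsub>G\<^esub> y) \<otimes>\<^bsub>G\<^esub> y = \<one>\<^bsub>G\<^esub>"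
    by (simp add: m_assoc yy flip: int_pow_mult)
  then have yi: "inv\<^bsub>G\<^esub> y = x [^]\<^bsub>G\<^esub> (-m) \<otimes>\<^bsub>G\<^esub> y" by (simp add: inv_equality)
  have yi1: "cl [(Y, False)] = inv\<^bsub>G\<^esub> y"
    using gp(2)[of "-1"] by (simp add: gen_pow_def int_pow_neg)
  have gen: "\<exists>k::int. cl w = x [^]\<^bsub>G\<^esub> k \<or> cl w = x [^]\<^bsub>G\<^esub> k \<otimes>\<^bsub>G\<^esub> y" for w
  proof (induction w)
    case Nil
    have "cl [] = x [^]\<^bsub>G\<^esub> (0::int)" by (simp add: one)
    then show ?case by blast
  next
    case (Cons l w)
    have cw: "cl (l # w) = cl [l] \<otimes>\<^bsub>G\<^esub> cl w" by (simp add: mult)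
    have X: "\<exists>k::int. x [^]\<^bsub>G\<^esub> j \<otimes>\<^bsub>G\<^esub> cl w = x [^]\<^bsub>G\<^esub> k \<or> x [^]\<^bsub>G\<^esub> j \<otimes>\<^bsub>G\<^esub> cl w = x [^]\<^bsub>G\<^esub> k \<otimes>\<^bsub>G\<^esub> y"
      if "\<exists>k::int. cl w = x [^]\<^bsub>G\<^esub> k \<or> cl w = x [^]\<^bsub>G\<^esub> k \<otimes>\<^bsub>G\<^esub> y" for j :: int and w
    proof -
      from that obtain k :: int where "cl w = x [^]\<^bsub>G\<^esub> k \<or> cl w = x [^]\<^bsub>G\<^esub> k \<otimes>\<^bsub>G\<^esub> y" by blast
      then have "x [^]\<^bsub>G\<^esub> j \<otimes>\<^bsub>G\<^esub> cl w = x [^]\<^bsub>G\<^esub> (j + k) \<or>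
          x [^]\<^bsub>G\<^esub> j \<otimes>\<^bsub>G\<^esub> cl w = x [^]\<^bsub>G\<^esub> (j + k) \<otimes>\<^bsub>G\<^esub> y"
        by (auto simp: int_pow_mult m_assoc)
      then show ?thesis by blast
    qed
    have Y: "\<exists>k::int. y \<otimes>\<^bsub>G\<^esub> cl w = x [^]\<^bsub>G\<^esub> k \<or> y \<otimes>\<^bsub>G\<^esub> cl w = x [^]\<^bsub>G\<^esub> k \<otimes>\<^bsub>G\<^esub> y"
    proof -
      from Cons obtain k :: int where "cl w = x [^]\<^bsub>G\<^esub> k \<or> cl w = x [^]\<^bsub>G\<^esub> k \<otimes>\<^bsub>G\<^esub> y" by blast
      then have "y \<otimes>\<^bsub>G\<^esub> cl w = x [^]\<^bsub>G\<^esub> (- k) \<otimes>\<^bsub>G\<^esub> y \<or> y \<otimes>\<^bsub>G\<^esub> cl w = x [^]\<^bsub>G\<^esub> (- k + m)"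
      proof
        assume a: "cl w = x [^]\<^bsub>G\<^esub> k \<otimes>\<^bsub>G\<^esub> y"
        have "y \<otimes>\<^bsub>G\<^esub> cl w = y \<otimes>\<^bsub>G\<^esub> x [^]\<^bsub>G\<^esub> k \<otimes>\<^bsub>G\<^esub> y" by (simp add: a m_assoc)
        also have "\<dots> = x [^]\<^bsub>G\<^esub> (- k) \<otimes>\<^bsub>G\<^esub> (y \<otimes>\<^bsub>G\<^esub> y)" unfolding yxk by (simp add: m_assoc)
        also have "\<dots> = x [^]\<^bsub>G\<^esub> (- k + m)" unfolding yy by (rule int_pow_mult[symmetric]) simp
        finally show ?thesis by blast
      qed (simp add: yxk)
      then show ?thesis by blast
    qed
    obtain g s where l: "l = (g, s)" by fastforce
    have yw: "cl ((Y, True) # w) = y \<otimes>\<^bsub>G\<^esub> cl w" by (simp add: y_def mult)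
    have yw': "cl [(Y, False)] \<otimes>\<^bsub>G\<^esub> cl w = x [^]\<^bsub>G\<^esub> (-m) \<otimes>\<^bsub>G\<^esub> cl ((Y, True) # w)"
    proof -
      have "cl w \<in> carrier G" by (simp add: car)
      then show ?thesis by (simp add: yi1 yi yw m_assoc)
    qed
    show ?case
    proof (cases g)
      case g: X
      have "\<exists>j::int. cl [l] = x [^]\<^bsub>G\<^esub> j"
      proof (cases s)
        case True
        have "cl [l] = x [^]\<^bsub>G\<^esub> (1::int)" unfolding l g iffD2[OF eq_True True] by (rule xi1)
        then show ?thesis by (rule exI)
      next
        case False
        have "cl [l] = x [^]\<^bsub>G\<^esub> (- 1::int)" unfolding l g iffD2[OF eq_False False] by (rule xi)
        then show ?thesis by (rule exI)
      qed
      then obtain j :: int where "cl [l] = x [^]\<^bsub>G\<^esub> j" by (elim exE)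
      then show ?thesis using X[OF Cons, of j] by (simp only: cw)
    next
      case g: Y
      have Y': "\<exists>k::int. cl ((Y, True) # w) = x [^]\<^bsub>G\<^esub> k \<or>
          cl ((Y, True) # w) = x [^]\<^bsub>G\<^esub> k \<otimes>\<^bsub>G\<^esub> y"
        unfolding yw by (rule Y)
      show ?thesis
      proof (cases s)
        case True
        show ?thesis unfolding l g iffD2[OF eq_True True] by (rule Y')
      next
        case False
        show ?thesis unfolding cw unfolding l g iffD2[OF eq_False False] yw' by (rule X[OF Y'])
      qed
    qed
  qed
  have sub: "carrier G \<subseteq> f ` ({..<ord x} \<times> UNIV)"
  proof
    fix z assume "z \<in> carrier G"
    then obtain w where "z = cl w" by (auto simp: car)
    with gen[of w] obtain k :: int where "z = x [^]\<^bsub>G\<^esub> k \<or> z = x [^]\<^bsub>G\<^esub> k \<otimes>\<^bsub>G\<^esub> y" by blast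
    with nfk[of k] obtain i where "i < ord x" "z = f (i, False) \<or> z = f (i, True)"
      by (auto simp: f_def)
    then show "z \<in> f ` ({..<ord x} \<times> UNIV)" by auto
  qed
  have le: "order G \<le> 2 * ord x"
  proof -
    have "order G \<le> card ({..<ord x} \<times> (UNIV :: bool set))"
      unfolding order_def by (rule surj_card_le[OF _ sub]) simp
    then show ?thesis by (simp add: card_cartesian_product)
  qed
  show ?thesis
  proof
    assume "order (H n m) = 2 * n"
    then have "n \<le> ord x" using le by (simp add: G_def)
    moreover have "ord x \<le> n" using xdn assms by (simp add: dvd_imp_le)
    ultimately show "int n dvd 2 * m" using x2m by simp
  next
    assume nm: "int n dvd 2 * m"
    define h where "h = (\<lambda>(i::nat, s). replicate i (X, True) @ (if s then [(Y, True)] else []))"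
    have ah: "fold (H_act m) (h (i, s)) (0, False) = (int i, s)" for i s
      by (simp add: h_def act_rep del: fold_replicate)
    have "inj_on (\<lambda>p. cl (h p)) ({..<n} \<times> UNIV)"
    proof (rule inj_onI)
      fix p q assume p: "p \<in> {..<n} \<times> (UNIV :: bool set)" and q: "q \<in> {..<n} \<times> UNIV"
        and "cl (h p) = cl (h q)"
      then have "pres_eq (H_rels n m) (h p) (h q)" by (simp add: cl_def pres_class_eq_iff)
      from act_pres[OF nm this, of "(0, False)"]
      have "snd p = snd q" and d: "int n dvd int (fst p) - int (fst q)"
        by (cases p; cases q; simp add: ah H_sim_def)+
      have "int (fst p) mod int n = int (fst q) mod int n" using d by (simp add: mod_eq_dvd_iff)
      then have "fst p = fst q" using p q by auto
      with \<open>snd p = snd q\<close> show "p = q" by (rule prod_eqI[rotated])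
    qed
    moreover have "(\<lambda>p. cl (h p)) ` ({..<n} \<times> UNIV) \<subseteq> carrier G" by (auto simp: car)
    moreover have "finite (carrier G)" using sub by (rule finite_subset) simp
    ultimately have "card ({..<n} \<times> (UNIV :: bool set)) \<le> card (carrier G)"
      by (rule card_inj_on_le)
    then have "2 * n \<le> order G" by (simp add: order_def card_cartesian_product)
    moreover have "ord x \<le> n" using xdn assms by (simp add: dvd_imp_le)
    ultimately show "order (H n m) = 2 * n" using le by (simp add: G_def)
  qed
qed

end

theory Submission
  imports Defs
begin

text \<open>
  If the group has order \<open>2n\<close> then \<open>n\<close> divides \<open>2m\<close>, and every element is uniquely \<open>x\<^sup>i y\<^sup>s\<close> with
  \<open>i\<close> modulo \<open>n\<close> and \<open>s\<close> a bit. When \<open>n\<close> or \<open>m\<close> is odd, the exponent is \<open>2n\<close>, and the product of all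
  elements is nontrivial in a cyclic quotient of order 2 or 4. (The case \<open>4 dvd n\<close>, \<open>m\<close> odd is void.)

  Let \<open>n = 2h\<close> and \<open>m\<close> be even; the exponent is \<open>n\<close>. The set \<open>{1, x, \<dots>, x\<^sup>n\<^sup>-\<^sup>1, y}\<close> gives the lower bound.
  For the upper bound, \<open>n + 2\<close> elements form exponent sets \<open>I\<close> (rotations) and \<open>J\<close> (reflections). Discard
  two elements so that both remaining sets have even size and the total exponent sum is even, and
  pair up cyclic neighbours in \<open>I\<close> and in \<open>J\<close>. Each of the two ways to do this in a set covers
  complementary arcs, so one of them has total length at most \<open>h\<close>. The orders of multiplication realise
  all signed sums of the resulting \<open>h\<close> positive differences (plus a multiple of \<open>m\<close>), and \<open>h\<close>
  positive integers with sum at most \<open>2h\<close> have enough subset sums to reach the required value, which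
  is \<open>0\<close> or \<open>h\<close> modulo \<open>n\<close>, unless all differences are 2. The latter is avoided by discarding elements
  so that one of the remaining exponent sets contains both parities; this is possible except for
  some subsets of the quaternion group (\<open>n = 4\<close>), where a product is exhibited.
\<close>

section \<open>Signed sums and pairings of integers\<close>

text \<open>Induction on the cardinality. Remove some \<open>i\<close> with
  \<open>d i \<ge> 2\<close>, or any \<open>i\<close> if all values are 1. The rest
  \<open>?L\<close> again satisfies the bound, and \<open>d i \<le> sum d ?L + 1\<close>, so the
  sums without \<open>i\<close> and the sums with \<open>i\<close> leave no gap between
  them.\<close>

lemma subset_sums_complete:
  fixes d :: "'i \<Rightarrow> int"
  assumes "finite K" "\<forall>i\<in>K. d i \<ge> 1" "sum d K \<le> 2 * int (card K) - 1 \<or> K = {}"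
    and "0 \<le> s" "s \<le> sum d K"
  shows "\<exists>T\<subseteq>K. sum d T = s"
  using assms
proof (induction "card K" arbitrary: K s)
  case 0
  then show ?case by auto
next
  case (Suc k)
  have ge: "int (card L) \<le> sum d L" if "L \<subseteq> K" for L
    using sum_mono[of L "\<lambda>_. 1" d] that Suc.prems(2) by auto
  obtain i where i: "i \<in> K" "d i \<ge> 2 \<or> (\<forall>j\<in>K. d j = 1)"
  proof (cases "\<exists>i\<in>K. d i \<ge> 2")
    case False
    then have "\<forall>j\<in>K. d j = 1" using Suc.prems(2) by force
    moreover have "K \<noteq> {}" using Suc.hyps(2) by auto
    ultimately show ?thesis using that by blast
  qed (use that in blast)
  let ?L = "K - {i}"
  have cL: "card ?L = k" using Suc.hyps(2) i(1) Suc.prems(1) by simp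
  have sK: "sum d K = d i + sum d ?L" using Suc.prems(1) i(1) by (rule sum.remove)
  have K: "sum d K \<le> 2 * int k + 1" using Suc.prems(3) Suc.hyps(2) i(1) by auto
  have L: "sum d ?L \<le> 2 * int (card ?L) - 1 \<or> ?L = {}"
  proof (cases "d i \<ge> 2")
    case True
    then show ?thesis using K sK cL by linarith
  next
    case False
    then have "sum d ?L = sum (\<lambda>_. 1) ?L" using i(2) by (intro sum.cong) auto
    then have s: "sum d ?L = int (card ?L)" by simp
    show ?thesis
    proof (cases "?L = {}")
      case False
      then have "card ?L \<ge> 1" using Suc.prems(1) by (simp add: Suc_leI card_gt_0_iff)
      then show ?thesis using s by linarith
    qed simp
  qed
  have IH: "\<exists>T\<subseteq>?L. sum d T = t" if "0 \<le> t" "t \<le> sum d ?L" for t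
    using Suc.hyps(1)[of ?L t] cL L that Suc.prems(1,2) by auto
  have "int k \<le> sum d ?L" using ge[of ?L] cL by auto
  then have di: "d i \<le> sum d ?L + 1" using sK K by linarith
  show ?case
  proof (cases "s \<le> sum d ?L")
    case True
    then show ?thesis using IH[OF Suc.prems(4)] by blast
  next
    case False
    then obtain T where T: "T \<subseteq> ?L" "sum d T = s - d i"
      using IH[of "s - d i"] di Suc.prems(5) sK by auto
    then have "sum d (insert i T) = s"
      using finite_subset[OF T(1)] Suc.prems(1) by (subst sum.insert) auto
    then show ?thesis using T(1) i(1) by (intro exI[of _ "insert i T"]) auto
  qed
qed

text \<open>With sign plus on \<open>T\<close> and minus elsewhere, the signed sum of
  \<open>d\<close> is \<open>2 * sum d T - sum d K\<close>; the signs are to be chosen so that it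
  reaches \<open>c\<close> modulo \<open>2 * h\<close>.\<close>

lemma signed_sum_hits:
  fixes d :: "'i \<Rightarrow> int" and h :: nat
  assumes fin: "finite K" and card: "card K = h" and pos: "\<forall>i\<in>K. 1 \<le> d i \<and> d i \<le> int h"
    and le: "sum d K \<le> 2 * int h" and ev: "even (sum d K)"
    and c: "c = 0 \<or> c = int h \<and> even h \<and> (sum d K = 2 * int h \<longrightarrow> (\<exists>i\<in>K. d i \<noteq> 2))"
  shows "\<exists>T\<subseteq>K. 2 * int h dvd 2 * sum d T - sum d K - c"
proof -
  have ge: "int h \<le> sum d K" using sum_mono[of K "\<lambda>_. 1" d] pos card by auto
  have evc: "even (sum d K - c)" using c ev by auto
  \<comment> \<open>A subset with sum \<open>?s\<close> has signed sum \<open>- c\<close>, which is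
    congruent to \<open>c\<close> because \<open>2 * c\<close> is a multiple of
    \<open>2 * h\<close>.\<close>
  let ?s = "(sum d K - c) div 2"
  have s: "2 * ?s = sum d K - c" using evc by simp
  have s0: "0 \<le> ?s" "?s \<le> sum d K" using c ge by auto
  have *: ?thesis if "\<exists>T\<subseteq>K. sum d T = ?s"
  proof -
    from that obtain T where "T \<subseteq> K" "sum d T = ?s" by blast
    then have "2 * sum d T - sum d K - c = - 2 * c" using s by linarith
    moreover have "2 * int h dvd - 2 * c" using c by auto
    ultimately show ?thesis using \<open>T \<subseteq> K\<close> by metis
  qed
  show ?thesis
  proof (cases "sum d K = 2 * int h")
    case False
    then have "sum d K \<le> 2 * int (card K) - 1" using le card by linarith
    then show ?thesis using subset_sums_complete[OF fin, of d ?s] pos s0 by (intro *) auto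
  next
    case eq: True
    show ?thesis
    proof (cases "c = 0")
      case True
      \<comment> \<open>With all signs positive the signed sum is the modulus \<open>2 * h\<close>
        itself.\<close>
      then show ?thesis using eq by (intro exI[of _ K]) auto
    next
      case False
      then have ex: "\<exists>i\<in>K. d i \<noteq> 2" using c eq by blast
      \<comment> \<open>The mean is 2 and not all values are 2. Without a value of at least 3 the
        rest is small enough for all its subset sums to occur, and the target is at most
        \<open>h\<close>, hence within reach because \<open>d i \<le> h\<close>.\<close>
      have "\<exists>i\<in>K. d i \<ge> 3"
      proof (rule ccontr)
        assume "\<not> ?thesis"
        then have "\<forall>i\<in>K. d i \<le> 2" by force
        moreover from this ex have "\<exists>i\<in>K. d i < 2" by force
        ultimately have "sum d K < sum (\<lambda>_. 2) K" by (intro sum_strict_mono_ex1 fin) auto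
        then show False using eq card by simp
      qed
      then obtain i where i: "i \<in> K" "d i \<ge> 3" by blast
      let ?L = "K - {i}"
      have sK: "sum d K = d i + sum d ?L" using fin i(1) by (rule sum.remove)
      have h: "h \<ge> 1" using card fin i(1) by (metis One_nat_def Suc_leI card_gt_0_iff empty_iff)
      have cL: "int (card ?L) = int h - 1" using fin i(1) card h by simp
      have L: "sum d ?L \<le> 2 * int (card ?L) - 1" using cL eq sK i(2) by simp
      have hs: "int h \<le> sum d ?L" using eq sK pos i(1) by force
      have "?s \<le> sum d ?L" using hs eq c False by linarith
      then obtain T where "T \<subseteq> ?L" "sum d T = ?s"
        using subset_sums_complete[of ?L d ?s] fin pos L s0 by auto
      then show ?thesis by (intro *) blast
    qed
  qed
qed

section \<open>Pairing neighbours on a circle\<close>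

definition mixed_parity :: "int set \<Rightarrow> bool" where
  "mixed_parity S \<longleftrightarrow> (\<exists>p\<in>S. \<exists>q\<in>S. odd (p + q))"

text \<open>The points cut a circle of circumference \<open>N\<close> into \<open>2 * a\<close>
  gaps. Taking every other gap pairs up neighbours in two ways, whose total lengths add up to
  \<open>N\<close>, so one of them has length at most half of \<open>N\<close>. The values of
  \<open>u\<close> and \<open>v\<close> are integer lifts, so that a pair across 0 still satisfies
  \<open>u i < v i\<close>.\<close>

lemma cyclic_pairing:
  fixes S :: "int set" and N :: int
  assumes S: "S \<subseteq> {0..<N}" and card: "card S = 2 * a" and a: "a > 0"
  shows "\<exists>u v. (\<forall>i<a. u i < v i) \<and> 2 * (\<Sum>i<a. v i - u i) \<le> N \<and>
     S = (\<lambda>i. u i mod N) ` {..<a} \<union> (\<lambda>i. v i mod N) ` {..<a} \<and>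
     (mixed_parity S \<longrightarrow> 2 * (\<Sum>i<a. v i - u i) < N \<or> (\<exists>i<a. v i - u i \<noteq> 2))"
proof -
  have fin: "finite S" using S by (rule finite_subset) simp
  define xs where "xs = sorted_list_of_set S"
  have len: "length xs = 2 * a" and set: "set xs = S" and srt: "sorted xs" "distinct xs"
    using fin card by (auto simp: xs_def)
  define f where "f k = (if k < 2 * a then xs ! k else xs ! 0 + N)" for k
  have memS: "xs ! k \<in> S" if "k < 2 * a" for k using that len set by (metis nth_mem)
  have step: "f k < f (Suc k)" if "k < 2 * a" for k
  proof (cases "Suc k < 2 * a")
    case True
    have "xs ! k \<le> xs ! Suc k" using srt(1) True len by (simp add: sorted_iff_nth_mono)
    moreover have "xs ! k \<noteq> xs ! Suc k" using srt(2) True len by (simp add: nth_eq_iff_index_eq)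
    ultimately show ?thesis using True by (simp add: f_def)
  next
    case False
    have "xs ! k < N" "0 \<le> xs ! 0" using memS[of k] memS[of 0] S that a by auto
    then show ?thesis using False that by (simp add: f_def)
  qed
  have fmod: "f k mod N = xs ! (if k < 2 * a then k else 0)" for k
    using memS[of k] memS[of 0] S a by (force simp: f_def)
  have img: "S = (\<lambda>i. f (2 * i + c) mod N) ` {..<a} \<union> (\<lambda>i. f (2 * i + c + 1) mod N) ` {..<a}"
    if c: "c < 2" for c
  proof
    show "S \<subseteq> (\<lambda>i. f (2 * i + c) mod N) ` {..<a} \<union> (\<lambda>i. f (2 * i + c + 1) mod N) ` {..<a}"
    proof
      fix z assume "z \<in> S"
      then obtain k where k: "k < 2 * a" "z = xs ! k" using set len by (metis in_set_conv_nth)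
      \<comment> \<open>For \<open>c = 1\<close> the point of index 0 is met only at position
        \<open>2 * a\<close>, after a full turn.\<close>
      define k' where "k' = (if k < c then 2 * a else k)"
      have "k = 0" if "k < c" using that c by simp
      then have z: "z = f k' mod N" using k by (auto simp: fmod k'_def)
      have k'b: "c \<le> k'" "k' < 2 * a + c" using k c a by (auto simp: k'_def)
      let ?i = "(k' - c) div 2"
      have "?i < a" "k' = 2 * ?i + c \<or> k' = 2 * ?i + c + 1" using k'b by linarith+
      then show "z \<in> (\<lambda>i. f (2 * i + c) mod N) ` {..<a} \<union> (\<lambda>i. f (2 * i + c + 1) mod N) ` {..<a}"
        using z by force
    qed
  qed (use a in \<open>auto simp: fmod memS\<close>)
  define D where "D c = (\<Sum>i<a. f (2 * i + c + 1) - f (2 * i + c))" for c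
  have "(\<Sum>i<b. f (2 * i + 1) - f (2 * i)) + (\<Sum>i<b. f (2 * i + 2) - f (2 * i + 1)) = f (2 * b) - f 0" for b
    by (induction b) auto
  from this[of a] have D: "D 0 + D 1 = N" using a by (simp add: D_def f_def)
  \<comment> \<open>If all gaps were 2, all points would have the parity of
    \<open>f 0\<close>.\<close>
  have odd2: "\<exists>k<2 * a. f (Suc k) - f k \<noteq> 2" if pq: "mixed_parity S"
  proof (rule ccontr)
    assume "\<not> ?thesis"
    then have st: "f (Suc k) = f k + 2" if "k < 2 * a" for k using that by force
    have "k < 2 * a \<Longrightarrow> even (f k - f 0)" for k
    proof (induction k)
      case (Suc k)
      then show ?case using st[of k] by simp
    qed simp
    then have "even (xs ! k - f 0)" if "k < 2 * a" for k using that by (metis f_def)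
    then have "even (p - f 0)" if "p \<in> S" for p using that set len by (metis in_set_conv_nth)
    then show False using pq unfolding mixed_parity_def by fastforce
  qed
  have main: ?thesis if c: "c < 2" and le: "2 * D c \<le> N"
    and ne: "mixed_parity S \<Longrightarrow> 2 * D c < N \<or> (\<exists>i<a. f (2 * i + c + 1) - f (2 * i + c) \<noteq> 2)"
    for c
  proof (intro exI conjI)
    show "\<forall>i<a. f (2 * i + c) < f (2 * i + c + 1)" using step c by auto
    show "2 * (\<Sum>i<a. f (2 * i + c + 1) - f (2 * i + c)) \<le> N" using le by (simp only: D_def)
    show "S = (\<lambda>i. f (2 * i + c) mod N) ` {..<a} \<union> (\<lambda>i. f (2 * i + c + 1) mod N) ` {..<a}"
      by (rule img[OF c])
    show "mixed_parity S \<longrightarrow>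
        2 * (\<Sum>i<a. f (2 * i + c + 1) - f (2 * i + c)) < N \<or>
        (\<exists>i<a. f (2 * i + c + 1) - f (2 * i + c) \<noteq> 2)"
      using ne unfolding D_def by (rule impI)
  qed
  consider "2 * D 0 < N" | "2 * D 1 < N" | "2 * D 0 = N" "2 * D 1 = N" using D by linarith
  then show ?thesis
  proof cases
    case 1
    show ?thesis by (rule main[of 0]) (use 1 in simp_all)
  next
    case 2
    show ?thesis by (rule main[of 1]) (use 2 in simp_all)
  next
    case 3
    show ?thesis
    proof (cases "mixed_parity S")
      case True
      \<comment> \<open>Both pairings have length exactly half of \<open>N\<close>, so the one that
        contains a gap different from 2 may be taken; the parity of \<open>k\<close> tells which one
        it is.\<close>
      then obtain k where k: "k < 2 * a" "f (Suc k) - f k \<noteq> 2" using odd2 by blast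
      have "2 * (k div 2) + k mod 2 = k" "k div 2 < a" using k(1) by auto
      then have ne: "\<exists>i<a. f (2 * i + k mod 2 + 1) - f (2 * i + k mod 2) \<noteq> 2"
        using k(2) by (metis Suc_eq_plus1)
      have "k mod 2 = 0 \<or> k mod 2 = 1" by auto
      then have "2 * D (k mod 2) = N" using 3 by (elim disjE) simp_all
      then show ?thesis by (intro main[of "k mod 2"] disjI2[OF ne]) simp_all
    next
      case False
      show ?thesis by (rule main[of 0]) (use 3 False in simp_all)
    qed
  qed
qed

text \<open>The cardinality forces the residues of all \<open>u i\<close> and \<open>v i\<close> to
  be distinct, so each is counted once in the sum of \<open>S\<close>. Reduction modulo an even
  \<open>N\<close> keeps parity, and \<open>v i - u i\<close> has the parity of
  \<open>u i + v i\<close>.\<close>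

lemma even_sum_pairing:
  fixes S :: "int set" and N :: int
  assumes S: "S = (\<lambda>i. u i mod N) ` {..<a} \<union> (\<lambda>i. v i mod N) ` {..<a}"
    and card: "card S = 2 * a" and N: "even N"
  shows "even (\<Sum>i<a. v i - u i) = even (\<Sum>S)"
proof -
  let ?U = "(\<lambda>i. u i mod N) ` {..<a}" and ?V = "(\<lambda>i. v i mod N) ` {..<a}"
  have "card ?U \<le> a" "card ?V \<le> a" using card_image_le[of "{..<a}"] by simp_all
  moreover have "card ?U + card ?V = 2 * a + card (?U \<inter> ?V)"
    using card S card_Un_Int[of ?U ?V] by simp
  ultimately have c: "card ?U = a" "card ?V = a" "card (?U \<inter> ?V) = 0" by linarith+
  then have dis: "?U \<inter> ?V = {}" by simp
  have "\<Sum>S = \<Sum>?U + \<Sum>?V" unfolding S using dis by (intro sum.union_disjoint) auto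
  also have "\<Sum>?U = (\<Sum>i<a. u i mod N)"
    using c(1) by (subst sum.reindex) (auto intro: eq_card_imp_inj_on)
  also have "\<Sum>?V = (\<Sum>i<a. v i mod N)"
    using c(2) by (subst sum.reindex) (auto intro: eq_card_imp_inj_on)
  finally have "\<Sum>S = (\<Sum>i<a. u i mod N + v i mod N)" by (simp add: sum.distrib)
  then have "(\<Sum>i<a. v i - u i) - \<Sum>S = (\<Sum>i<a. (v i - v i mod N) - (u i - u i mod N) - 2 * (u i mod N))"
    by (simp only: sum_subtractf[symmetric]) (intro sum.cong, simp_all)
  also have "even \<dots>"
  proof (rule dvd_sum)
    fix i
    have *: "even (z - z mod N)" for z using N by (simp add: minus_mod_eq_mult_div)
    show "even ((v i - v i mod N) - (u i - u i mod N) - 2 * (u i mod N))"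
      by (intro dvd_diff * dvd_triv_left)
  qed
  finally show ?thesis by simp
qed

section \<open>Discarding two elements under parity conditions\<close>

text \<open>Only \<open>h\<close> integers of each parity lie below \<open>2 * h\<close>, so at most
  \<open>h\<close> elements of \<open>I\<close> have the opposite parity.\<close>

lemma card_parity_ge:
  fixes I :: "int set"
  assumes I: "I \<subseteq> {0..<2 * int h}" and card: "h + r \<le> card I"
  shows "r \<le> card {i \<in> I. even i = b}"
proof -
  have fin: "finite I" using I by (rule finite_subset) simp
  have "{i \<in> I. even i \<noteq> b} \<subseteq> (\<lambda>k. 2 * int k + of_bool b) ` {..<h}"
  proof
    fix i assume "i \<in> {i \<in> I. even i \<noteq> b}"
    then have i: "0 \<le> i" "i < 2 * int h" "even i \<noteq> b" using I by auto
    have "i = 2 * int (nat (i div 2)) + of_bool b" using i by (cases b) auto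
    moreover have "nat (i div 2) < h" using i by auto
    ultimately show "i \<in> (\<lambda>k. 2 * int k + of_bool b) ` {..<h}" by blast
  qed
  then have "card {i \<in> I. even i \<noteq> b} \<le> card {..<h}" by (rule surj_card_le[rotated]) simp
  moreover have "card I = card {i \<in> I. even i = b} + card {i \<in> I. even i \<noteq> b}"
    using fin by (subst card_Un_disjoint[symmetric]) (auto intro: arg_cong[where f = card])
  ultimately show ?thesis using card by simp
qed

lemma ex_parity:
  fixes I :: "int set"
  assumes "I \<subseteq> {0..<2 * int h}" "h + 1 \<le> card I"
  shows "\<exists>i\<in>I. even i = b"
  using card_parity_ge[OF assms, of b] by (cases "{i \<in> I. even i = b} = {}") auto

lemma ex_two_of_parity:
  fixes I :: "int set"
  assumes "I \<subseteq> {0..<2 * int h}" "h + 2 \<le> card I"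
  shows "\<exists>i\<in>I. \<exists>j\<in>I. i \<noteq> j \<and> even i = b \<and> even j = b"
proof (rule ccontr)
  assume "\<not> ?thesis"
  then obtain i where "{i \<in> I. even i = b} \<subseteq> {i}" by blast
  then have "card {i \<in> I. even i = b} \<le> card {i}" by (rule card_mono[rotated]) simp
  then show False using card_parity_ge[OF assms, of b] by simp
qed

lemma mixed_parityI: "p \<in> S \<Longrightarrow> q \<in> S \<Longrightarrow> even p \<Longrightarrow> odd q \<Longrightarrow> mixed_parity S"
  unfolding mixed_parity_def by auto

text \<open>The larger set has at least \<open>h + 1\<close> elements and thus both parities, which
  leaves room to correct the parity of the total sum. Both discarded elements come from
  \<open>I\<close> if \<open>card I\<close> is even; otherwise one comes from each set. In the last
  alternative \<open>I\<close> consists of all residues modulo 4, and discarding two elements of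
  equal parity leaves two of equal parity.\<close>

lemma select_from_larger:
  fixes I J :: "int set"
  assumes I: "I \<subseteq> {0..<2 * int h}" and J: "J \<subseteq> {0..<2 * int h}"
    and card: "card I + card J = 2 * h + 2" "card J \<le> card I" and h: "h \<ge> 2"
  obtains I' J' where "I' \<subseteq> I" "J' \<subseteq> J" "card I' + card J' = 2 * h" "even (card I')"
    "I' \<noteq> {}" "J' \<noteq> {}" "even (\<Sum>I' + \<Sum>J')"
    "odd h \<or> mixed_parity I' \<or> h = 2 \<and> card I = 4 \<and> even (\<Sum>I + \<Sum>J)"
proof -
  note found = that
  have fin: "finite I" "finite J" using I J by (auto intro: finite_subset)
  have cI: "card I \<le> 2 * h" using card_mono[OF _ I] by simp
  have cIh: "h + 1 \<le> card I" using card by simp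
  have J2: "card J \<ge> 2" using cI card by simp
  have nmono: "mixed_parity S" if "p \<in> S" "q \<in> S" "even p" "odd q" for p q S
    using that by (rule mixed_parityI)
  show thesis
  proof (cases "even (card I)")
    case even: True
    have two: thesis if ab: "a \<in> I" "b \<in> I" "a \<noteq> b" "even (a + b) = even (\<Sum>I + \<Sum>J)"
      and nm: "odd h \<or> mixed_parity (I - {a, b}) \<or> h = 2 \<and> card I = 4 \<and> even (\<Sum>I + \<Sum>J)" for a b
    proof (rule found[of "I - {a, b}" J])
      have c: "card (I - {a, b}) = card I - 2" using ab fin by (simp add: card_Diff_subset)
      show "card (I - {a, b}) + card J = 2 * h" "even (card (I - {a, b}))"
        using c card cIh h even by auto
      have "card (I - {a, b}) \<noteq> 0" using c cIh h by simp
      then show "I - {a, b} \<noteq> {}" by (metis card.empty)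
      show "J \<noteq> {}" using J2 by auto
      have "\<Sum>(I - {a, b}) = \<Sum>I - \<Sum>{a, b}" using ab fin by (intro sum_diff) auto
      then show "even (\<Sum>(I - {a, b}) + \<Sum>J)" using ab by auto
    qed (use nm in auto)
    obtain p q where pq: "p \<in> I" "q \<in> I" "even p" "odd q"
      using ex_parity[OF I cIh, of True] ex_parity[OF I cIh, of False] by auto
    show thesis
    proof (cases "even h")
      case False
      show thesis
      proof (cases "even (\<Sum>I + \<Sum>J)")
        case True
        have "\<not> I \<subseteq> {p, q}" using card_mono[of "{p, q}" I] cIh h card_insert_le_m1[of 2 "{q}" p] by auto
        then obtain z where z: "z \<in> I" "z \<noteq> p" "z \<noteq> q" by blast
        show thesis
        proof (cases "even z")
          case ev: True
          show thesis by (rule two[of z p]) (use z pq True False ev in auto)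
        next
          case od: False
          show thesis by (rule two[of z q]) (use z pq True False od in auto)
        qed
      next
        case od: False
        show thesis by (rule two[of p q]) (use pq False od in auto)
      qed
    next
      case True
      \<comment> \<open>Both \<open>card I\<close> and \<open>h\<close> are even, so the excess of
        \<open>card I\<close> over \<open>h\<close> is at least 2.\<close>
      then have I2: "h + 2 \<le> card I" using even cIh by (cases "card I = h + 1") auto
      obtain p p' where p: "p \<in> I" "p' \<in> I" "p \<noteq> p'" "even p" "even p'"
        using ex_two_of_parity[OF I I2, of True] by auto
      obtain q q' where q: "q \<in> I" "q' \<in> I" "q \<noteq> q'" "odd q" "odd q'"
        using ex_two_of_parity[OF I I2, of False] by auto
      show thesis
      proof (cases "even (\<Sum>I + \<Sum>J)")
        case False
        have "mixed_parity (I - {p, q})" using p q by (intro nmono[of p' _ q']) auto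
        then show thesis by (intro two[of p q]) (use p q False in auto)
      next
        case ev: True
        show thesis
        proof (cases "card I = 4")
          case True
          then have "h = 2" using I2 h by simp
          then show thesis by (intro two[of p p']) (use p ev True in auto)
        next
          case False
          \<comment> \<open>A fifth element \<open>z\<close> is discarded together with
            \<open>p\<close> or \<open>q\<close>, whichever shares its parity; both parities
            survive.\<close>
          have "\<not> I \<subseteq> {p, p', q, q'}"
          proof
            assume "I \<subseteq> {p, p', q, q'}"
            then have "card I \<le> card {p, p', q, q'}" by (intro card_mono) auto
            also have "\<dots> \<le> 4" by (auto simp: card_insert_if)
            finally show False using False I2 h by simp
          qed
          then obtain z where z: "z \<in> I" "z \<notin> {p, p', q, q'}" by blast
          show thesis
          proof (cases "even z")
            case True
            have "mixed_parity (I - {z, p})" using p q z True by (intro nmono[of p' _ q]) auto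
            then show thesis by (intro two[of z p]) (use p z ev True in auto)
          next
            case False
            have "mixed_parity (I - {z, q})" using p q z False by (intro nmono[of p _ q']) auto
            then show thesis by (intro two[of z q]) (use q z ev False in auto)
          qed
        qed
      qed
    qed
  next
    case oddI: False
    have one: thesis if ab: "a \<in> I" "b \<in> J" "even (a + b) = even (\<Sum>I + \<Sum>J)"
      and nm: "odd h \<or> mixed_parity (I - {a})" for a b
    proof (rule found[of "I - {a}" "J - {b}"])
      have c: "card (I - {a}) = card I - 1" "card (J - {b}) = card J - 1" using ab fin by simp_all
      show "card (I - {a}) + card (J - {b}) = 2 * h" "even (card (I - {a}))"
        using c card J2 oddI by (auto elim: oddE)
      have "card (I - {a}) \<noteq> 0" "card (J - {b}) \<noteq> 0" using c cIh h J2 by auto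
      then show "I - {a} \<noteq> {}" "J - {b} \<noteq> {}" by (metis card.empty)+
      have "\<Sum>(I - {a}) = \<Sum>I - a" "\<Sum>(J - {b}) = \<Sum>J - b" using ab fin by (simp_all add: sum_diff1)
      then show "even (\<Sum>(I - {a}) + \<Sum>(J - {b}))" using ab by auto
    qed (use nm in auto)
    show thesis
    proof (cases "h + 2 \<le> card I")
      case I2: True
      obtain p p' where p: "p \<in> I" "p' \<in> I" "p \<noteq> p'" "even p" "even p'"
        using ex_two_of_parity[OF I I2, of True] by auto
      obtain q q' where q: "q \<in> I" "q' \<in> I" "q \<noteq> q'" "odd q" "odd q'"
        using ex_two_of_parity[OF I I2, of False] by auto
      have "mixed_parity (I - {p})" using p q by (intro nmono[of p' _ q']) auto
      moreover have "mixed_parity (I - {q})" using p q by (intro nmono[of p' _ q']) auto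
      moreover obtain b where "b \<in> J" using J2 by fastforce
      ultimately show thesis
        using one[of p b] one[of q b] p(1,4) q(1,4) by (cases "even (p + b) = even (\<Sum>I + \<Sum>J)") simp_all
    next
      case False
      \<comment> \<open>Both sets have exactly \<open>h + 1\<close> elements here. Hence
        \<open>J\<close> has both parities too, and the element taken from \<open>J\<close> corrects
        the parity of the sum.\<close>
      then have "h + 1 \<le> card J" using card by simp
      then obtain p' q' where J': "p' \<in> J" "q' \<in> J" "even p'" "odd q'"
        using ex_parity[OF J, of True] ex_parity[OF J, of False] by auto
      obtain p q where pq: "p \<in> I" "q \<in> I" "even p" "odd q"
        using ex_parity[OF I cIh, of True] ex_parity[OF I cIh, of False] by auto
      have "\<not> I \<subseteq> {p, q}" using card_mono[of "{p, q}" I] cIh h card_insert_le_m1[of 2 "{q}" p] by auto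
      then obtain z where z: "z \<in> I" "z \<noteq> p" "z \<noteq> q" by blast
      have "mixed_parity (I - {z})" using pq z by (intro nmono[of p _ q]) auto
      then show thesis
        using one[of z p'] one[of z q'] J' z(1) by (cases "even (z + p') = even (\<Sum>I + \<Sum>J)") simp_all
    qed
  qed
qed

lemma select_even:
  fixes I J :: "int set"
  assumes "I \<subseteq> {0..<2 * int h}" "J \<subseteq> {0..<2 * int h}" "card I + card J = 2 * h + 2" "h \<ge> 2"
  obtains I' J' where "I' \<subseteq> I" "J' \<subseteq> J" "card I' + card J' = 2 * h" "even (card I')"
    "I' \<noteq> {}" "J' \<noteq> {}" "even (\<Sum>I' + \<Sum>J')"
    "odd h \<or> mixed_parity I' \<or> mixed_parity J' \<or>
       h = 2 \<and> (card I = 4 \<or> card J = 4) \<and> even (\<Sum>I + \<Sum>J)"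
proof (cases "card J \<le> card I")
  case True
  obtain I' J' where *: "I' \<subseteq> I" "J' \<subseteq> J" "card I' + card J' = 2 * h" "even (card I')"
    "I' \<noteq> {}" "J' \<noteq> {}" "even (\<Sum>I' + \<Sum>J')"
    "odd h \<or> mixed_parity I' \<or> h = 2 \<and> card I = 4 \<and> even (\<Sum>I + \<Sum>J)"
    by (rule select_from_larger[OF assms(1,2,3) True assms(4)])
  show thesis by (rule that[OF *(1-7)]) (use *(8) in argo)
next
  case False
  have c: "card J + card I = 2 * h + 2" "card I \<le> card J" using False assms(3) by auto
  obtain J' I' where *: "J' \<subseteq> J" "I' \<subseteq> I" "card J' + card I' = 2 * h" "even (card J')"
    "J' \<noteq> {}" "I' \<noteq> {}" "even (\<Sum>J' + \<Sum>I')"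
    "odd h \<or> mixed_parity J' \<or> h = 2 \<and> card J = 4 \<and> even (\<Sum>J + \<Sum>I)"
    by (rule select_from_larger[OF assms(2,1) c assms(4)])
  have c': "card I' + card J' = 2 * h" "even (card I')" using *(3,4) by presburger+
  have s: "even (\<Sum>I' + \<Sum>J')" "\<Sum>J + \<Sum>I = \<Sum>I + \<Sum>J" using *(7) by (simp_all add: add.commute)
  show thesis by (rule that[OF *(2,1) c' *(6,5) s(1)]) (use *(8)[unfolded s(2)] in argo)
qed

section \<open>Groups with normal form\<close>

lemma harborth_propertyD:
  fixes G (structure)
  assumes "harborth_property G k" "A \<subseteq> carrier G" "card A = k"
  shows "\<exists>xs. distinct xs \<and> set xs \<subseteq> A \<and> length xs = group_exp G \<and> foldr (\<otimes>) xs \<one> = \<one>"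
  using assms by (simp add: harborth_property_def)

text \<open>The element \<open>e i s\<close> stands for \<open>x^i y^s\<close> with an arbitrary
  integer \<open>i\<close>, so exponents need no reduction in calculations. The rule
  \<open>e_mult\<close> combines \<open>y x^j = x^(-j) y\<close> with
  \<open>y^2 = x^m\<close>.\<close>

locale H_normal_form = group G for G (structure) +
  fixes n :: nat and m :: int and e :: "int \<Rightarrow> bool \<Rightarrow> 'a"
  assumes n_ge_2: "n \<ge> 2"
    and n_dvd: "int n dvd 2 * m"
    and carrier_e: "carrier G = range (\<lambda>(i, s). e i s)"
    and e_eq_iff: "e i s = e j t \<longleftrightarrow> s = t \<and> int n dvd i - j"
    and e_mult: "e i s \<otimes> e j t =
      e (i + (if s then - j else j) + (if s \<and> t then m else 0)) (s \<noteq> t)"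
begin

lemma e_closed [simp]: "e i s \<in> carrier G"
  by (auto simp: carrier_e)

lemma e_one: "e 0 False = \<one>"
  using e_mult[of 0 False 0 False] by (simp add: r_cancel_one)

lemma e_eq_one: "e i s = \<one> \<longleftrightarrow> \<not> s \<and> int n dvd i"
  by (simp add: e_eq_iff flip: e_one)

lemma e_mod: "e (i mod int n) s = e i s"
  by (simp add: e_eq_iff mod_eq_dvd_iff[symmetric])

lemma e_bij: "bij_betw (\<lambda>(i, s). e i s) ({0..<int n} \<times> UNIV) (carrier G)"
  unfolding bij_betw_def
proof
  show "inj_on (\<lambda>(i, s). e i s) ({0..<int n} \<times> UNIV)"
    by (auto simp: inj_on_def e_eq_iff simp flip: mod_eq_dvd_iff)
  show "(\<lambda>(i, s). e i s) ` ({0..<int n} \<times> UNIV) = carrier G"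
  proof
    show "carrier G \<subseteq> (\<lambda>(i, s). e i s) ` ({0..<int n} \<times> UNIV)"
    proof
      fix z assume "z \<in> carrier G"
      then obtain i s where "z = e (i mod int n) s" by (auto simp: carrier_e e_mod)
      then show "z \<in> (\<lambda>(i, s). e i s) ` ({0..<int n} \<times> UNIV)" using n_ge_2 by force
    qed
  qed auto
qed

lemma finite_carrier: "finite (carrier G)"
  using bij_betw_finite[OF e_bij] by simp

lemma order_eq: "order G = 2 * n"
  using bij_betw_same_card[OF e_bij] by (simp add: order_def card_cartesian_product)

section \<open>Element orders and the exponent\<close>

lemma rotation_pow: "e i False [^] (k :: nat) = e (int k * i) False"
  by (induction k) (simp_all add: e_one e_mult algebra_simps)

lemma reflection_pow_even: "e i True [^] (2 * k :: nat) = e (int k * m) False"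
proof -
  have "e i True [^] (2 :: nat) = e m False"
    by (simp add: numeral_2_eq_2 e_mult)
  then have "e i True [^] (2 * k :: nat) = e m False [^] k"
    by (metis e_closed nat_pow_pow)
  then show ?thesis by (simp add: rotation_pow)
qed

lemma reflection_pow_odd: "odd k \<Longrightarrow> \<exists>j. e i True [^] (k :: nat) = e j True"
  by (elim oddE) (auto simp: reflection_pow_even e_mult)

lemma ord_rotation: "ord (e 1 False) = n"
proof (rule dvd_antisym)
  show "ord (e 1 False) dvd n" by (simp add: rotation_pow e_eq_one flip: pow_eq_id)
  have "e 1 False [^] ord (e 1 False) = \<one>" by simp
  then show "n dvd ord (e 1 False)" by (simp add: rotation_pow e_eq_one)
qed

text \<open>Odd powers of a reflection are reflections, never the identity.\<close>

lemma even_ord_reflection: "even (ord (e i True))"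
proof (rule ccontr)
  assume "odd (ord (e i True))"
  then obtain j where "e i True [^] ord (e i True) = e j True" using reflection_pow_odd by blast
  then have "e j True = \<one>" by simp
  then show False by (simp add: e_eq_one)
qed

lemma group_exp_dvd_order: "group_exp G dvd 2 * n"
  unfolding group_exp_def
  by (rule Lcm_least) (use ord_dvd_group_order order_eq in auto)

lemma ord_dvd_group_exp: "ord (e i s) dvd group_exp G"
  unfolding group_exp_def by (rule dvd_Lcm) simp

lemma n_dvd_group_exp: "n dvd group_exp G"
  using ord_dvd_group_exp[of 1 False] by (simp add: ord_rotation)

text \<open>The rotation \<open>x\<close> contributes the odd factor \<open>n\<close>, and any
  reflection contributes 2.\<close>

lemma group_exp_odd:
  assumes "odd n"
  shows "group_exp G = 2 * n"
proof (rule dvd_antisym[OF group_exp_dvd_order])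
  have "2 dvd group_exp G" using even_ord_reflection ord_dvd_group_exp by (rule dvd_trans)
  then show "2 * n dvd group_exp G" using n_dvd_group_exp assms by (intro divides_mult) auto
qed

text \<open>Since \<open>y^(2k) = x^(k m)\<close> with \<open>n\<close> even and \<open>m\<close>
  odd, this power is trivial only for even \<open>k\<close>. So 4 divides the order of
  \<open>y\<close>, and 4 is coprime to the odd number \<open>n div 2\<close>.\<close>

lemma group_exp_odd_m:
  assumes "n mod 4 = 2" "odd m"
  shows "group_exp G = 2 * n"
proof (rule dvd_antisym[OF group_exp_dvd_order])
  have n: "n = 2 * (n div 2)" "odd (n div 2)" using assms(1) by presburger+
  obtain k where k: "ord (e 0 True) = 2 * k" using even_ord_reflection[of 0] by (elim evenE)
  have "e 0 True [^] (2 * k) = \<one>" unfolding k[symmetric] by simp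
  then have "int n dvd int k * m" by (simp add: reflection_pow_even e_eq_one)
  then have "2 dvd int k * m" using n(1) by (metis dvd_trans dvd_triv_left int_ops(7) of_nat_numeral)
  then have "even k" using assms(2) by simp
  then have "4 dvd ord (e 0 True)" unfolding k by auto
  then have "4 dvd group_exp G" using ord_dvd_group_exp by (rule dvd_trans)
  moreover have "n div 2 dvd group_exp G" using n_dvd_group_exp n(1) by (metis dvd_mult_right)
  moreover have "coprime 4 (n div 2)" using n(2) coprime_power_left_iff[of 2 2 "n div 2"] by simp
  ultimately have "4 * (n div 2) dvd group_exp G" by (intro divides_mult)
  moreover have "4 * (n div 2) = 2 * n" using n(1) by simp
  ultimately show "2 * n dvd group_exp G" by simp
qed

text \<open>For \<open>n = 2 * h\<close> and \<open>m = 2 * l\<close>, the \<open>n\<close>-th power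
  of a reflection is \<open>x^(h m) = x^(n l)\<close>.\<close>

lemma group_exp_even:
  assumes "even n" "even m"
  shows "group_exp G = n"
proof (rule dvd_antisym[OF _ n_dvd_group_exp])
  have "e i s [^] n = \<one>" for i s
  proof (cases s)
    case True
    obtain h l where "n = 2 * h" "m = 2 * l" using assms by (auto elim!: evenE)
    then show ?thesis using reflection_pow_even[of i h] True by (simp add: e_eq_one)
  qed (simp add: rotation_pow e_eq_one)
  then have "ord (e i s) dvd n" for i s using pow_eq_id[of "e i s" n] by simp
  then show "group_exp G dvd n"
    unfolding group_exp_def by (intro Lcm_least) (auto simp: carrier_e)
qed

section \<open>Products of lists and their abelian invariants\<close>

lemma foldr_closed: "set xs \<subseteq> carrier G \<Longrightarrow> foldr (\<otimes>) xs \<one> \<in> carrier G"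
  by (induction xs) auto

lemma foldr_append:
  "set xs \<subseteq> carrier G \<Longrightarrow> set ys \<subseteq> carrier G \<Longrightarrow>
    foldr (\<otimes>) (xs @ ys) \<one> = foldr (\<otimes>) xs \<one> \<otimes> foldr (\<otimes>) ys \<one>"
  by (induction xs) (auto simp: m_assoc foldr_closed)

definition coord :: "'a \<Rightarrow> int \<times> bool" where
  "coord = inv_into ({0..<int n} \<times> UNIV) (\<lambda>(i, s). e i s)"

lemma e_coord: "z \<in> carrier G \<Longrightarrow> e (fst (coord z)) (snd (coord z)) = z"
  using bij_betw_inv_into_right[OF e_bij] by (simp add: coord_def case_prod_unfold)

lemma bij_coord: "bij_betw coord (carrier G) ({0..<int n} \<times> UNIV)"
  unfolding coord_def by (rule bij_betw_inv_into[OF e_bij])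

lemma coord_e: "coord (e i s) = (i mod int n, s)"
proof -
  have "(i mod int n, s) \<in> {0..<int n} \<times> UNIV" using n_ge_2 by simp
  from bij_betw_inv_into_left[OF e_bij this] show ?thesis by (simp add: coord_def e_mod)
qed

text \<open>The abelian quotients of order 2 and (for odd \<open>m\<close>) 4, as invariants of products.\<close>

lemma product_invariants:
  assumes "set xs \<subseteq> carrier G"
  shows "\<exists>i s. foldr (\<otimes>) xs \<one> = e i s \<and> (s \<longleftrightarrow> odd (\<Sum>z\<leftarrow>xs. of_bool (snd (coord z)) :: int)) \<and>
    ((\<forall>z\<in>set xs. \<not> snd (coord z)) \<longrightarrow> i = (\<Sum>z\<leftarrow>xs. fst (coord z))) \<and>
    (odd m \<longrightarrow> 4 dvd (\<Sum>z\<leftarrow>xs. 2 * fst (coord z) + of_bool (snd (coord z))) - (2 * i + of_bool s))"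
  using assms
proof (induction xs)
  case Nil
  then show ?case by (auto intro!: exI[of _ 0] exI[of _ False] simp: e_one)
next
  case (Cons z xs)
  then obtain i s where IH: "foldr (\<otimes>) xs \<one> = e i s"
    "s \<longleftrightarrow> odd (\<Sum>z\<leftarrow>xs. of_bool (snd (coord z)) :: int)"
    "(\<forall>z\<in>set xs. \<not> snd (coord z)) \<longrightarrow> i = (\<Sum>z\<leftarrow>xs. fst (coord z))"
    "odd m \<longrightarrow> 4 dvd (\<Sum>z\<leftarrow>xs. 2 * fst (coord z) + of_bool (snd (coord z))) - (2 * i + of_bool s)"
    by auto
  obtain j t where jt: "coord z = (j, t)" by fastforce
  let ?i = "j + (if t then - i else i) + (if t \<and> s then m else 0)"
  have "foldr (\<otimes>) (z # xs) \<one> = e ?i (t \<noteq> s)"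
    using e_coord[of z] Cons.prems e_mult[of j t i s] by (simp add: IH(1) jt)
  \<comment> \<open>Weight 2 for \<open>x\<close> and 1 for \<open>y\<close> is additive modulo 4:
    inverting a rotation keeps its weight, and \<open>x^m\<close> has weight 2 like
    \<open>y^2\<close>.\<close>
  moreover have "4 dvd (\<Sum>z\<leftarrow>z # xs. 2 * fst (coord z) + of_bool (snd (coord z)))
    - (2 * ?i + of_bool (t \<noteq> s))" if "odd m"
  proof -
    define S where "S = (\<Sum>z\<leftarrow>xs. 2 * fst (coord z) + of_bool (snd (coord z)))"
    have "4 dvd S - (2 * i + of_bool s)" using IH(4) that by (simp add: S_def)
    then have "4 dvd 2 * j + of_bool t + S - (2 * ?i + of_bool (t \<noteq> s))"
      using that by (cases s; cases t; simp only: of_bool_eq if_True if_False simp_thms; presburger)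
    then show ?thesis by (simp add: jt S_def)
  qed
  ultimately show ?case
  proof (intro exI conjI impI)
    show "(t \<noteq> s) \<longleftrightarrow> odd (\<Sum>z\<leftarrow>z # xs. of_bool (snd (coord z)) :: int)"
      using IH(2) by (simp add: jt)
    assume rot: "\<forall>w\<in>set (z # xs). \<not> snd (coord w)"
    have "\<not> t" using rot by (simp add: jt)
    moreover have "i = (\<Sum>z\<leftarrow>xs. fst (coord z))" using IH(3) rot by simp
    ultimately show "?i = (\<Sum>z\<leftarrow>z # xs. fst (coord z))" by (simp add: jt)
  qed
qed

lemma sum_list_coord_carrier:
  assumes "distinct xs" "set xs = carrier G"
  shows "(\<Sum>z\<leftarrow>xs. f (coord z)) = (\<Sum>i\<in>{0..<int n}. f (i, False) + f (i, True))"
proof -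
  have "(\<Sum>z\<leftarrow>xs. f (coord z)) = (\<Sum>z\<in>carrier G. f (coord z))"
    using assms by (simp add: sum_list_distinct_conv_sum_set)
  also have "\<dots> = (\<Sum>p\<in>{0..<int n} \<times> UNIV. f p)" by (rule sum.reindex_bij_betw[OF bij_coord])
  also have "\<dots> = (\<Sum>i\<in>{0..<int n}. f (i, False) + f (i, True))"
    by (simp add: sum.cartesian_product' UNIV_bool)
  finally show ?thesis .
qed

lemma sum_int_lessThan: "2 * \<Sum>{0..<int k} = int k * (int k - 1)"
proof (induction k)
  case (Suc k)
  have "{0..<int (Suc k)} = insert (int k) {0..<int k}" by auto
  then show ?case using Suc by (simp add: algebra_simps)
qed simp

section \<open>Groups in which every subset size fails\<close>

text \<open>As the exponent is the group order, only the product of all elements matters. For odd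
  \<open>n\<close> it has an odd number of reflection factors. Otherwise its weight is congruent to
  \<open>n\<close>, hence to 2 modulo 4, whereas the identity has weight 0.\<close>

lemma harborth_full:
  assumes exp: "group_exp G = 2 * n" and c: "odd n \<or> n mod 4 = 2 \<and> odd m"
  shows "harborth G = 2 * n + 1"
proof -
  have "\<not> harborth_property G (2 * n)"
  proof
    assume "harborth_property G (2 * n)"
    then obtain xs where xs: "distinct xs" "set xs \<subseteq> carrier G" "length xs = 2 * n"
      "foldr (\<otimes>) xs \<one> = \<one>"
      unfolding harborth_property_def exp using order_eq by (auto simp: order_def)
    have set: "set xs = carrier G"
      using xs order_eq finite_carrier by (intro card_subset_eq) (auto simp: distinct_card order_def)
    obtain i s where inv: "e i s = \<one>" "s \<longleftrightarrow> odd (\<Sum>z\<leftarrow>xs. of_bool (snd (coord z)) :: int)"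
      "odd m \<longrightarrow> 4 dvd (\<Sum>z\<leftarrow>xs. 2 * fst (coord z) + of_bool (snd (coord z))) - (2 * i + of_bool s)"
      using product_invariants[OF xs(2), unfolded xs(4)] by (elim exE conjE) (rule that[OF sym])
    have s: "\<not> s" and i: "int n dvd i" using inv(1) by (auto simp: e_eq_one)
    have "(\<Sum>z\<leftarrow>xs. of_bool (snd (coord z)) :: int) = int n"
      using sum_list_coord_carrier[OF xs(1) set, of "\<lambda>p. of_bool (snd p) :: int"] by simp
    then have "even n" using inv(2) s by simp
    then have n: "n mod 4 = 2" "odd m" using c by auto
    have "(\<Sum>z\<leftarrow>xs. 2 * fst (coord z) + of_bool (snd (coord z))) = 4 * \<Sum>{0..<int n} + int n"
      using sum_list_coord_carrier[OF xs(1) set, of "\<lambda>p. 2 * fst p + of_bool (snd p)"]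
      by (simp add: sum.distrib sum_distrib_left)
    then have "4 dvd 4 * \<Sum>{0..<int n} + int n - 2 * i" using inv(3) n s by simp
    moreover have "even i" using i \<open>even n\<close> by (meson dvd_trans even_of_nat)
    ultimately have "4 dvd n" by presburger
    then show False using n by simp
  qed
  then have "\<not> (\<exists>k. group_exp G \<le> k \<and> k \<le> order G \<and> harborth_property G k)"
    unfolding exp order_eq by (metis le_antisym)
  then show ?thesis unfolding harborth_def by (simp only: if_False order_eq)
qed

text \<open>Every element is its own inverse, so two distinct elements never multiply to the
  identity, and the default value \<open>order G + 1\<close> applies.\<close>

lemma harborth_klein:
  assumes "n = 2" "even m"
  shows "harborth G = 5"
proof -
  have exp: "group_exp G = 2" using group_exp_even assms by simp
  have "\<not> harborth_property G k" if k: "k \<le> order G" for k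
  proof
    assume "harborth_property G k"
    obtain A where A: "A \<subseteq> carrier G" "card A = k"
      using k unfolding order_def by (meson obtain_subset_with_card_n)
    obtain xs where xs: "distinct xs" "set xs \<subseteq> A" "length xs = 2" "foldr (\<otimes>) xs \<one> = \<one>"
      using harborth_propertyD[OF \<open>harborth_property G k\<close> A] unfolding exp
      by (elim exE conjE)
    then obtain a b where ab: "xs = [a, b]" by (auto simp: numeral_2_eq_2 length_Suc_conv)
    have car: "a \<in> carrier G" "b \<in> carrier G" using xs ab A by auto
    have "ord b dvd group_exp G" using car by (auto simp: group_exp_def)
    then have "b \<otimes> b = \<one>"
      using car unfolding exp by (simp flip: pow_eq_id add: numeral_2_eq_2)
    moreover have "a \<otimes> b = \<one>" using xs(4) ab car by simp
    ultimately have "a = b" using car by (metis inv_equality)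
    then show False using xs ab by simp
  qed
  then show ?thesis unfolding harborth_def order_eq using assms by auto
qed

lemma inj_e: "inj_on (\<lambda>i. e i s) {0..<int n}"
  by (auto simp: inj_on_def e_eq_iff simp flip: mod_eq_dvd_iff)

text \<open>If \<open>y\<close> occurs, it is the only reflection, so the product is a reflection.
  Otherwise all rotations occur, and their exponent sum \<open>n (n - 1) / 2\<close> is not a
  multiple of the even number \<open>n\<close>.\<close>

lemma no_trivial_product:
  assumes "even n" "distinct xs" "length xs = n"
    and sub: "set xs \<subseteq> insert (e 0 True) (range (\<lambda>i. e i False))"
  shows "foldr (\<otimes>) xs \<one> \<noteq> \<one>"
proof
  assume one: "foldr (\<otimes>) xs \<one> = \<one>"
  have car: "set xs \<subseteq> carrier G" using sub by auto
  obtain i s where inv: "e i s = \<one>" "s \<longleftrightarrow> odd (\<Sum>z\<leftarrow>xs. of_bool (snd (coord z)) :: int)"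
    "(\<forall>z\<in>set xs. \<not> snd (coord z)) \<longrightarrow> i = (\<Sum>z\<leftarrow>xs. fst (coord z))"
    using product_invariants[OF car, unfolded one] by (elim exE conjE) (rule that[OF sym])
  have s: "\<not> s" and i: "int n dvd i" using inv(1) by (auto simp: e_eq_one)
  have "e 0 True \<notin> set xs"
  proof
    assume y: "e 0 True \<in> set xs"
    have "(\<Sum>z\<leftarrow>xs. of_bool (snd (coord z)) :: int) = (\<Sum>z\<in>set xs. of_bool (snd (coord z)))"
      using assms(2) by (simp add: sum_list_distinct_conv_sum_set)
    also have "\<dots> = 1 + (\<Sum>z\<in>set xs - {e 0 True}. of_bool (snd (coord z)))"
      using y by (subst sum.remove) (auto simp: coord_e)
    also have "(\<Sum>z\<in>set xs - {e 0 True}. of_bool (snd (coord z)) :: int) = 0"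
      using sub by (intro sum.neutral) (auto simp: coord_e)
    finally show False using inv(2) s by simp
  qed
  then have rot: "set xs \<subseteq> range (\<lambda>i. e i False)" using sub by auto
  let ?R = "(\<lambda>i. e i False) ` {0..<int n}"
  have "set xs \<subseteq> ?R"
  proof
    fix z assume "z \<in> set xs"
    then obtain i where "z = e (i mod int n) False" using rot by (auto simp: e_mod)
    then show "z \<in> ?R" using n_ge_2 by auto
  qed
  moreover have "card (set xs) = card ?R" using assms by (simp add: distinct_card card_image inj_e)
  ultimately have set: "set xs = ?R" by (intro card_subset_eq) auto
  have "i = (\<Sum>z\<in>set xs. fst (coord z))"
    using inv(3) rot assms(2) by (auto simp: coord_e sum_list_distinct_conv_sum_set)
  also have "\<dots> = (\<Sum>j\<in>{0..<int n}. fst (coord (e j False)))"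
    unfolding set by (subst sum.reindex[OF inj_e]) simp
  also have "\<dots> = \<Sum>{0..<int n}" by (intro sum.cong) (auto simp: coord_e)
  finally have "2 * i = int n * (int n - 1)" using sum_int_lessThan by simp
  moreover obtain k where "i = int n * k" using i by (elim dvdE)
  ultimately have "int n * (2 * k) = int n * (int n - 1)" by simp
  then have "2 * k = int n - 1" using n_ge_2 by (subst (asm) mult_cancel_left) auto
  then show False using assms(1) by presburger
qed

section \<open>Orders of multiplication that realise signed sums\<close>

lemma rotation_product:
  "foldr (\<otimes>) (map (\<lambda>i. e (P i) False) is) \<one> = e (\<Sum>i\<leftarrow>is. P i) False"
  by (induction "is") (simp_all add: e_one e_mult)

lemma reflection_pair_product:
  "foldr (\<otimes>) (concat (map (\<lambda>k. [e (P k) True, e (Q k) True]) ks)) \<one> =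
    e (\<Sum>k\<leftarrow>ks. P k - Q k + m) False"
  by (induction ks) (simp_all add: e_one e_mult algebra_simps)

text \<open>A rotation before a reflection and one after it contribute with opposite signs.\<close>

lemma alternating_product:
  assumes "b > 0"
  shows "foldr (\<otimes>) (map (\<lambda>i. e (P i) False) [0..<a] @ e (P' 0) True #
      map (\<lambda>i. e (Q i) False) [0..<a] @ e (Q' 0) True #
      concat (map (\<lambda>k. [e (P' k) True, e (Q' k) True]) [1..<b])) \<one> =
    e ((\<Sum>i<a. P i - Q i) + (\<Sum>k<b. P' k - Q' k) + int b * m) False"
proof -
  let ?tail = "concat (map (\<lambda>k. [e (P' k) True, e (Q' k) True]) [1..<b])"
  have tail: "set ?tail \<subseteq> carrier G" by auto
  have rot: "set (map (\<lambda>i. e (R i) False) is) \<subseteq> carrier G" for R and "is" :: "nat list" by auto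
  have split: "(\<Sum>k<b. P' k - Q' k) = P' 0 - Q' 0 + (\<Sum>k\<in>{1..<b}. P' k - Q' k)"
    using assms sum.atLeast_Suc_lessThan[of 0 b "\<lambda>k. P' k - Q' k"] by (simp add: atLeast0LessThan)
  let ?R = "\<Sum>k\<in>{1..<b}. P' k - Q' k + m"
  have "foldr (\<otimes>) (e (Q' 0) True # ?tail) \<one> = e (Q' 0 - ?R) True"
    by (simp add: reflection_pair_product e_mult interv_sum_list_conv_sum_set_nat)
  moreover have "set (e (Q' 0) True # ?tail) \<subseteq> carrier G" using tail by simp
  ultimately have *: "foldr (\<otimes>) (map (\<lambda>i. e (Q i) False) [0..<a] @ e (Q' 0) True # ?tail) \<one> =
      e ((\<Sum>i<a. Q i) + Q' 0 - ?R) True"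
    by (simp only: foldr_append[OF rot] rotation_product e_mult interv_sum_list_conv_sum_set_nat)
      (simp add: atLeast0LessThan add_diff_eq)
  \<comment> \<open>The first reflection negates the exponent of what follows: the \<open>Q\<close>
    rotations and \<open>Q' 0\<close> acquire a minus sign, while \<open>?R\<close>, already negated
    by the second reflection, becomes positive again.\<close>
  have "foldr (\<otimes>) (e (P' 0) True # map (\<lambda>i. e (Q i) False) [0..<a] @ e (Q' 0) True # ?tail) \<one> =
      e (P' 0 - ((\<Sum>i<a. Q i) + Q' 0 - ?R) + m) False"
    by (simp only: foldr.simps comp_apply * e_mult) (simp add: algebra_simps)
  moreover have "set (e (P' 0) True # map (\<lambda>i. e (Q i) False) [0..<a] @ e (Q' 0) True # ?tail) \<subseteq> carrier G"
    using tail by auto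
  ultimately have "foldr (\<otimes>) (map (\<lambda>i. e (P i) False) [0..<a] @ e (P' 0) True #
      map (\<lambda>i. e (Q i) False) [0..<a] @ e (Q' 0) True # ?tail) \<one> =
    e ((\<Sum>i<a. P i) + (P' 0 - ((\<Sum>i<a. Q i) + Q' 0 - ?R) + m)) False"
    by (simp only: foldr_append[OF rot] rotation_product e_mult interv_sum_list_conv_sum_set_nat)
      (simp add: atLeast0LessThan)
  also have "?R = (\<Sum>k\<in>{1..<b}. P' k - Q' k) + (int b - 1) * m"
    using assms by (simp add: sum.distrib of_nat_diff)
  also have "(\<Sum>i<a. P i) + (P' 0 - ((\<Sum>i<a. Q i) + Q' 0 -
      ((\<Sum>k\<in>{1..<b}. P' k - Q' k) + (int b - 1) * m)) + m) =
      (\<Sum>i<a. P i - Q i) + (\<Sum>k<b. P' k - Q' k) + int b * m"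
    by (simp add: split sum_subtractf[of P Q] left_diff_distrib)
  finally show ?thesis .
qed

text \<open>Exchanging the members of some pairs keeps the set of elements, so every choice of signs
  multiplies the same elements.\<close>

lemma swap_image:
  "(\<lambda>i. e (if R i then v i else u i) s) ` K \<union> (\<lambda>i. e (if R i then u i else v i) s) ` K =
    (\<lambda>i. e i s) ` ((\<lambda>i. u i mod int n) ` K \<union> (\<lambda>i. v i mod int n) ` K)"
proof -
  have "(\<lambda>i. e i s) ` ((\<lambda>i. u i mod int n) ` K \<union> (\<lambda>i. v i mod int n) ` K) =
      (\<Union>i\<in>K. {e (u i) s, e (v i) s})"
    by (simp add: image_Un image_image e_mod) blast
  moreover have "{e (if R i then v i else u i) s, e (if R i then u i else v i) s} = {e (u i) s, e (v i) s}" for i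
    by auto
  ultimately show ?thesis by (simp add: UN_insert_distrib image_Un set_eq_iff) blast
qed

lemma card_e_images:
  assumes "I \<subseteq> {0..<int n}" "J \<subseteq> {0..<int n}"
  shows "card ((\<lambda>i. e i False) ` I \<union> (\<lambda>i. e i True) ` J) = card I + card J"
proof -
  have fin: "finite I" "finite J" using assms by (auto intro: finite_subset)
  have "(\<lambda>i. e i False) ` I \<inter> (\<lambda>i. e i True) ` J = {}" by (auto simp: e_eq_iff)
  then have "card ((\<lambda>i. e i False) ` I \<union> (\<lambda>i. e i True) ` J) =
      card ((\<lambda>i. e i False) ` I) + card ((\<lambda>i. e i True) ` J)"
    using fin by (intro card_Un_disjoint) auto
  then show ?thesis using inj_on_subset[OF inj_e] assms by (simp add: card_image)
qed

text \<open>Pairing neighbours in \<open>I\<close> and in \<open>J\<close> yields \<open>h\<close>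
  positive differences of total at most \<open>n\<close>. By \<open>alternating_product\<close> each
  signed sum of them, plus \<open>b * m\<close>, is the exponent of some product;
  \<open>signed_sum_hits\<close> makes it vanish modulo \<open>n\<close>.\<close>

lemma trivial_product_of_pairs:
  assumes n: "n = 2 * h" and "even m"
    and I: "I \<subseteq> {0..<int n}" and J: "J \<subseteq> {0..<int n}"
    and card: "card I = 2 * a" "card J = 2 * b" "a + b = h" and pos: "a > 0" "b > 0"
    and ev: "even (\<Sum>I + \<Sum>J)"
    and gen: "odd h \<or> mixed_parity I \<or> mixed_parity J \<or> int n dvd int b * m"
  shows "\<exists>xs. distinct xs \<and> set xs = (\<lambda>i. e i False) ` I \<union> (\<lambda>i. e i True) ` J \<and>
    length xs = n \<and> foldr (\<otimes>) xs \<one> = \<one>"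
proof -
  have evn: "even (int n)" using n by simp
  obtain u v where uv: "\<forall>i<a. u i < v i" "2 * (\<Sum>i<a. v i - u i) \<le> int n"
    "I = (\<lambda>i. u i mod int n) ` {..<a} \<union> (\<lambda>i. v i mod int n) ` {..<a}"
    "mixed_parity I \<longrightarrow> 2 * (\<Sum>i<a. v i - u i) < int n \<or> (\<exists>i<a. v i - u i \<noteq> 2)"
    using cyclic_pairing[OF I card(1) pos(1)]
    by (elim exE conjE) (rule that)
  obtain u' v' where uv': "\<forall>i<b. u' i < v' i" "2 * (\<Sum>i<b. v' i - u' i) \<le> int n"
    "J = (\<lambda>i. u' i mod int n) ` {..<b} \<union> (\<lambda>i. v' i mod int n) ` {..<b}"
    "mixed_parity J \<longrightarrow> 2 * (\<Sum>i<b. v' i - u' i) < int n \<or> (\<exists>i<b. v' i - u' i \<noteq> 2)"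
    using cyclic_pairing[OF J card(2) pos(2)]
    by (elim exE conjE) (rule that)
  define K where "K = {..<a} <+> {..<b}"
  define d where "d = case_sum (\<lambda>i. v i - u i) (\<lambda>k. v' k - u' k)"
  let ?S = "\<Sum>i<a. v i - u i" and ?S' = "\<Sum>k<b. v' k - u' k"
  have fin: "finite K" by (simp add: K_def)
  have cK: "card K = h" using card(3) by (simp add: K_def card_Plus)
  have sumK: "sum f K = (\<Sum>i<a. f (Inl i)) + (\<Sum>k<b. f (Inr k))" for f :: "nat + nat \<Rightarrow> int"
    by (simp add: K_def sum.Plus comp_def)
  have dK: "sum d K = ?S + ?S'" by (simp add: sumK d_def)
  have "v i - u i \<le> ?S" if "i < a" for i
    by (rule member_le_sum) (use uv(1) that in \<open>auto simp: less_imp_le\<close>)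
  moreover have "v' k - u' k \<le> ?S'" if "k < b" for k
    by (rule member_le_sum) (use uv'(1) that in \<open>auto simp: less_imp_le\<close>)
  ultimately have bounds: "\<forall>i\<in>K. 1 \<le> d i \<and> d i \<le> int h"
    using uv(1,2) uv'(1,2) unfolding n by (fastforce simp: K_def d_def)
  have le: "sum d K \<le> 2 * int h" using uv(2) uv'(2) unfolding dK n by simp
  have "even ?S = even (\<Sum>I)" by (rule even_sum_pairing[OF uv(3) card(1) evn])
  moreover have "even ?S' = even (\<Sum>J)" by (rule even_sum_pairing[OF uv'(3) card(2) evn])
  ultimately have evd: "even (sum d K)" using ev unfolding dK by simp
  \<comment> \<open>The target \<open>c\<close> represents \<open>- b * m\<close> modulo
    \<open>n\<close>. It is 0 or \<open>h\<close> because \<open>n\<close> divides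
    \<open>2 * m\<close>; in the second case \<open>b * m\<close> is an odd multiple of
    \<open>h\<close>, and it is even, so \<open>h\<close> is even.\<close>
  obtain c where c: "2 * int h dvd c + int b * m"
    "c = 0 \<or> c = int h \<and> even h \<and> (sum d K = 2 * int h \<longrightarrow> (\<exists>i\<in>K. d i \<noteq> 2))"
  proof (cases "int n dvd int b * m")
    case True
    then show ?thesis using that[of 0] n by simp
  next
    case False
    have "2 * int h dvd 2 * (int b * m)" using n_dvd n by (simp add: dvd_mult mult.left_commute)
    then have "int h dvd int b * m" by simp
    then obtain k where k: "int b * m = int h * k" by (elim dvdE)
    have "odd k" using False k n by (auto elim!: evenE)
    moreover have "even (int h * k)" using \<open>even m\<close> by (simp flip: k)
    ultimately have h: "even h" by simp
    have "int h + int b * m = int h * (1 + k)" using k by (simp add: algebra_simps)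
    then have "2 * int h dvd int h + int b * m" using \<open>odd k\<close> by (auto elim!: oddE)
    \<comment> \<open>Total \<open>2 * h\<close> means that both pairings have the maximal length
      \<open>h\<close>; mixed parity then provides a difference other than 2.\<close>
    moreover have "\<exists>i\<in>K. d i \<noteq> 2" if "sum d K = 2 * int h"
    proof -
      have eq: "2 * ?S = int n" "2 * ?S' = int n" using that uv(2) uv'(2) unfolding dK n by simp_all
      have "mixed_parity I \<or> mixed_parity J" using gen h False by simp
      then have "(\<exists>i<a. v i - u i \<noteq> 2) \<or> (\<exists>k<b. v' k - u' k \<noteq> 2)"
        using uv(4) uv'(4) eq by auto
      then show ?thesis by (force simp: K_def d_def)
    qed
    ultimately show ?thesis using h by (intro that[of "int h"]) auto
  qed
  obtain T where T: "T \<subseteq> K" "2 * int h dvd 2 * sum d T - sum d K - c"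
    using signed_sum_hits[OF fin cK bounds le evd c(2)] by blast
  have "sum d T = (\<Sum>i\<in>K. if i \<in> T then d i else 0)"
    using fin T(1) by (simp add: sum.inter_restrict[symmetric] Int_absorb1)
  then have "2 * sum d T - sum d K = (\<Sum>i\<in>K. 2 * (if i \<in> T then d i else 0) - d i)"
    by (simp only: sum_subtractf sum_distrib_left)
  also have "\<dots> = (\<Sum>i\<in>K. if i \<in> T then d i else - d i)" by (intro sum.cong) auto
  finally have signed: "2 * sum d T - sum d K = (\<Sum>i\<in>K. if i \<in> T then d i else - d i)" .
  \<comment> \<open>A pair in \<open>T\<close> puts its larger member in the positive slot
    \<open>P\<close> or \<open>P'\<close>; any other pair puts its smaller member there.\<close>
  define P where "P i = (if Inl i \<in> T then v i else u i)" for i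
  define Q where "Q i = (if Inl i \<in> T then u i else v i)" for i
  define P' where "P' k = (if Inr k \<in> T then v' k else u' k)" for k
  define Q' where "Q' k = (if Inr k \<in> T then u' k else v' k)" for k
  let ?X = "(\<Sum>i<a. P i - Q i) + (\<Sum>k<b. P' k - Q' k)"
  have "?X = 2 * sum d T - sum d K"
    unfolding signed unfolding sumK
    by (intro arg_cong2[where f = "(+)"] sum.cong) (auto simp: P_def Q_def P'_def Q'_def d_def)
  then have "?X + int b * m = (2 * sum d T - sum d K - c) + (c + int b * m)" by simp
  then have X: "int n dvd ?X + int b * m" unfolding n using dvd_add[OF T(2) c(1)] by (simp only: of_nat_mult of_nat_numeral)
  define xs where "xs = map (\<lambda>i. e (P i) False) [0..<a] @ e (P' 0) True #
      map (\<lambda>i. e (Q i) False) [0..<a] @ e (Q' 0) True #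
      concat (map (\<lambda>k. [e (P' k) True, e (Q' k) True]) [1..<b])"
  have prod: "foldr (\<otimes>) xs \<one> = \<one>"
    unfolding xs_def alternating_product[OF pos(2)] using X by (simp add: e_eq_one)
  have "length (concat (map (\<lambda>k. [f k, g k]) ks)) = 2 * length ks" for f g :: "nat \<Rightarrow> 'a" and ks
    by (induction ks) auto
  then have len: "length xs = n" using pos card(3) n by (simp add: xs_def)
  have "{..<b} = insert 0 {1..<b}" using pos(2) by auto
  then have "set xs = ((\<lambda>i. e (P i) False) ` {..<a} \<union> (\<lambda>i. e (Q i) False) ` {..<a}) \<union>
      ((\<lambda>i. e (P' i) True) ` {..<b} \<union> (\<lambda>i. e (Q' i) True) ` {..<b})"
    by (auto simp: xs_def)
  then have set: "set xs = (\<lambda>i. e i False) ` I \<union> (\<lambda>i. e i True) ` J"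
    unfolding P_def Q_def P'_def Q'_def swap_image uv(3)[symmetric] uv'(3)[symmetric] .
  \<comment> \<open>The list is as long as its set is large, which gives distinctness.\<close>
  then have "card (set xs) = length xs" using card_e_images[OF I J] card n len by simp
  then have "distinct xs" by (rule card_distinct)
  then show ?thesis using set len prod by blast
qed

section \<open>The constant for even \<open>n\<close> and \<open>m\<close>\<close>

lemma harborth_property_even:
  assumes "even n" "even m" "n \<noteq> 2"
  shows "harborth_property G (n + 2)"
  unfolding harborth_property_def
proof (intro allI impI, elim conjE)
  fix A assume A: "A \<subseteq> carrier G" "card A = n + 2"
  obtain h where n: "n = 2 * h" using \<open>even n\<close> by (elim evenE)
  have h: "h \<ge> 2" using n n_ge_2 \<open>n \<noteq> 2\<close> by simp
  define I where "I = {i \<in> {0..<int n}. e i False \<in> A}"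
  define J where "J = {i \<in> {0..<int n}. e i True \<in> A}"
  have sub: "I \<subseteq> {0..<int n}" "J \<subseteq> {0..<int n}" by (auto simp: I_def J_def)
  have "A \<subseteq> (\<lambda>i. e i False) ` I \<union> (\<lambda>i. e i True) ` J"
  proof
    fix z assume z: "z \<in> A"
    then obtain i s where eq: "z = e (i mod int n) s" using A by (auto simp: carrier_e e_mod)
    have "i mod int n \<in> {0..<int n}" using n_ge_2 by simp
    then have "z \<in> (\<lambda>i. e i s) ` {i \<in> {0..<int n}. e i s \<in> A}" using z unfolding eq by blast
    then show "z \<in> (\<lambda>i. e i False) ` I \<union> (\<lambda>i. e i True) ` J" by (cases s) (simp_all add: I_def J_def)
  qed
  then have AIJ: "A = (\<lambda>i. e i False) ` I \<union> (\<lambda>i. e i True) ` J" by (auto simp: I_def J_def)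
  have card: "card I + card J = 2 * h + 2" using A(2) card_e_images[OF sub] n by (simp add: AIJ)
  have "\<exists>xs. distinct xs \<and> set xs \<subseteq> A \<and> length xs = n \<and> foldr (\<otimes>) xs \<one> = \<one>"
  proof -
    have subh: "I \<subseteq> {0..<2 * int h}" "J \<subseteq> {0..<2 * int h}" using sub n by simp_all
    obtain I' J' where IJ: "I' \<subseteq> I" "J' \<subseteq> J" "card I' + card J' = 2 * h" "even (card I')"
      "I' \<noteq> {}" "J' \<noteq> {}" "even (\<Sum>I' + \<Sum>J')"
      "odd h \<or> mixed_parity I' \<or> mixed_parity J' \<or>
        h = 2 \<and> (card I = 4 \<or> card J = 4) \<and> even (\<Sum>I + \<Sum>J)"
      by (rule select_even[OF subh card h])
    have fin: "finite I'" "finite J'" using IJ(1,2) sub by (meson finite_atLeastLessThan_int finite_subset)+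
    obtain a where a: "card I' = 2 * a" using IJ(4) by (elim evenE)
    have "even (card J')" using IJ(3,4) by presburger
    then obtain b where b: "card J' = 2 * b" by (elim evenE)
    have pos: "a > 0" "b > 0" using a b fin IJ(5,6) by (metis card_0_eq gr0I mult_0_right)+
    have ab: "a + b = h" using IJ(3) a b by simp
    show ?thesis
    proof (cases "odd h \<or> mixed_parity I' \<or> mixed_parity J' \<or> int n dvd int b * m")
      case True
      have sub': "I' \<subseteq> {0..<int n}" "J' \<subseteq> {0..<int n}" using IJ(1,2) sub by auto
      obtain xs where "distinct xs" "set xs = (\<lambda>i. e i False) ` I' \<union> (\<lambda>i. e i True) ` J'"
        "length xs = n" "foldr (\<otimes>) xs \<one> = \<one>"
        using trivial_product_of_pairs[OF n \<open>even m\<close> sub' a b ab pos IJ(7) True]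
        by (elim exE conjE) (rule that)
      moreover have "(\<lambda>i. e i False) ` I' \<union> (\<lambda>i. e i True) ` J' \<subseteq> A"
        using IJ(1,2) unfolding AIJ by blast
      ultimately show ?thesis by metis
    next
      case False
      \<comment> \<open>What remains is \<open>n = 4\<close> with \<open>m\<close> congruent to 2
        modulo 4, the quaternion group, where all rotations or all reflections lie in
        \<open>A\<close>.\<close>
      have h2: "h = 2" and c4: "card I = 4 \<or> card J = 4" and ev: "even (\<Sum>I + \<Sum>J)"
        using IJ(8) False by auto
      have n4: "n = 4" using n h2 by simp
      have "\<not> 4 dvd m" using False n4 by auto
      then have m2: "4 dvd m + 2" using \<open>even m\<close> by presburger
      have full: "S = {0, 1, 2, 3}" if "card S = 4" "S \<subseteq> {0..<int n}" for S :: "int set"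
      proof -
        have "{0..<int n} = {0, 1, 2, 3}" unfolding n4 by auto
        then show ?thesis using that by (intro card_subset_eq) auto
      qed
      show ?thesis
      proof (cases "card I = 4")
        case True
        have I: "I = {0, 1, 2, 3}" by (rule full[OF True sub(1)])
        have "card J = 2" using card True h2 by simp
        then obtain j k where jk: "J = {j, k}" "j \<noteq> k" by (auto simp: card_2_iff)
        have "j \<in> {0..<4}" "k \<in> {0..<4}" using sub(2) jk n4 by auto
        moreover have "even (j + k)" using ev jk I by simp
        ultimately have "4 dvd j - k + 2" using jk(2) unfolding atLeastLessThan_iff by presburger
        then have d: "4 dvd 1 + (3 + (j - k + m))" using m2 by presburger
        \<comment> \<open>The product has exponent \<open>1 + 3 + j - k + m\<close>, where both
          \<open>j - k\<close> and \<open>m\<close> are congruent to 2 modulo 4.\<close>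
        let ?xs = "[e 1 False, e 3 False, e j True, e k True]"
        have "distinct ?xs" "set ?xs \<subseteq> A"
          using jk \<open>j \<in> _\<close> \<open>k \<in> _\<close> n4 I by (auto simp: e_eq_iff AIJ simp flip: mod_eq_dvd_iff)
        moreover have "foldr (\<otimes>) ?xs \<one> = \<one>" using d by (simp add: e_mult e_eq_one n4)
        moreover have "length ?xs = n" using n4 by simp
        ultimately show ?thesis by blast
      next
        case False
        then have J: "J = {0, 1, 2, 3}" using c4 full sub(2) by blast
        \<comment> \<open>The order is chosen so that the differences \<open>0 - 1\<close> and
          \<open>3 - 2\<close> cancel and the exponent is \<open>2 * m\<close>.\<close>
        let ?xs = "[e 0 True, e 1 True, e 3 True, e 2 True]"
        have "distinct ?xs" "set ?xs \<subseteq> A"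
          using n4 J by (auto simp: e_eq_iff AIJ)
        moreover have "4 dvd 2 * m" using n_dvd n4 by simp
        then have "foldr (\<otimes>) ?xs \<one> = \<one>" by (simp add: e_mult e_eq_one n4)
        moreover have "length ?xs = n" using n4 by simp
        ultimately show ?thesis by blast
      qed
    qed
  qed
  then show "\<exists>xs. distinct xs \<and> set xs \<subseteq> A \<and> length xs = group_exp G \<and> foldr (\<otimes>) xs \<one> = \<one>"
    using group_exp_even assms by simp
qed

lemma not_harborth_property_small:
  assumes "even n" "even m" "k \<le> n + 1"
  shows "\<not> harborth_property G k"
proof
  assume k: "harborth_property G k"
  \<comment> \<open>All rotations together with \<open>y\<close>: any subset of this set inherits
    the lack of a trivial product of \<open>n\<close> elements.\<close>
  let ?B = "(\<lambda>i. e i False) ` {0..<int n} \<union> (\<lambda>i. e i True) ` {0}"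
  have "card ?B = n + 1" using n_ge_2 by (subst card_e_images) auto
  then obtain A where A: "A \<subseteq> ?B" "card A = k" using assms(3) by (metis obtain_subset_with_card_n)
  have "A \<subseteq> carrier G" using A(1) by auto
  then obtain xs where xs: "distinct xs" "set xs \<subseteq> A" "length xs = n" "foldr (\<otimes>) xs \<one> = \<one>"
    using harborth_propertyD[OF k _ A(2)] group_exp_even[OF assms(1,2)] by auto
  have "set xs \<subseteq> insert (e 0 True) (range (\<lambda>i. e i False))" using xs(2) A(1) by auto
  then show False using no_trivial_product[OF assms(1) xs(1,3)] xs(4) by blast
qed

lemma harborth_even:
  assumes "even n" "even m" "n \<noteq> 2"
  shows "harborth G = n + 2"
proof -
  have exp: "group_exp G = n" using assms by (intro group_exp_even)
  have P: "harborth_property G (n + 2)" by (rule harborth_property_even[OF assms])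
  have "(LEAST k. group_exp G \<le> k \<and> harborth_property G k) = n + 2"
  proof (rule Least_equality)
    show "group_exp G \<le> n + 2 \<and> harborth_property G (n + 2)" using P exp by simp
    fix k assume "group_exp G \<le> k \<and> harborth_property G k"
    then show "n + 2 \<le> k" using not_harborth_property_small[OF assms(1,2), of k] by linarith
  qed
  moreover have "\<exists>k. group_exp G \<le> k \<and> k \<le> order G \<and> harborth_property G k"
    using P exp order_eq n_ge_2 by (intro exI[of _ "n + 2"]) auto
  ultimately show ?thesis unfolding harborth_def by (simp only: if_True)
qed

end

section \<open>The normal form in the presented group\<close>

text \<open>The relations alone give the multiplication rule and show that the \<open>2 * n\<close>
  normal forms exhaust the group; the assumed order then makes them pairwise distinct.\<close>

lemma H_has_normal_form:
  assumes n: "n \<ge> 2" and ord: "order (H n m) = 2 * n"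
  shows "\<exists>e. H_normal_form (H n m) n m e"
proof -
  define G where "G = H n m"
  interpret group G unfolding G_def by (rule group_H)
  define cl where "cl = pres_class (H_rels n m)"
  define x where "x = cl [(X, True)]"
  define y where "y = cl [(Y, True)]"
  have mult: "cl u \<otimes>\<^bsub>G\<^esub> cl v = cl (u @ v)" for u v
    by (simp add: G_def H_def cl_def presented_group_mult)
  have car: "carrier G = range cl" by (simp add: G_def H_def cl_def presented_group_carrier)
  have one: "\<one>\<^bsub>G\<^esub> = cl []" by (simp add: G_def H_def cl_def presented_group_one)
  have [simp]: "x \<in> carrier G" "y \<in> carrier G" by (auto simp: x_def y_def car)
  have gp: "cl (gen_pow X k) = x [^]\<^bsub>G\<^esub> k" "cl (gen_pow Y k) = y [^]\<^bsub>G\<^esub> k" for k :: int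
    by (simp_all add: G_def H_def cl_def x_def y_def pres_class_gen_pow)
  have rel: "cl u = cl v" if "(u, v) \<in> H_rels n m" for u v
    using pres_rel[OF that, of "[]" "[]"] by (simp add: cl_def pres_class_eq_iff)
  have xn: "x [^]\<^bsub>G\<^esub> (int n) = \<one>\<^bsub>G\<^esub>"
    using rel[of "gen_pow X (int n)" "[]"] by (simp add: H_rels_def gp one)
  have yy: "y \<otimes>\<^bsub>G\<^esub> y = x [^]\<^bsub>G\<^esub> m"
    using rel[of "gen_pow Y 2" "gen_pow X m"] int_pow_mult[of y 1 1] by (simp add: H_rels_def gp)
  have yx: "y \<otimes>\<^bsub>G\<^esub> x = inv\<^bsub>G\<^esub> x \<otimes>\<^bsub>G\<^esub> y"
    using rel[of "gen_pow Y 1 @ gen_pow X 1" "gen_pow X (- 1) @ gen_pow Y 1"]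
    by (simp add: H_rels_def gp int_pow_neg flip: mult)
  \<comment> \<open>This yields the commutation rule for the inverse of \<open>x\<close>, which the
    induction needs for negative exponents.\<close>
  have "x \<otimes>\<^bsub>G\<^esub> y \<otimes>\<^bsub>G\<^esub> x = y" by (simp add: m_assoc yx r_inv_ex flip: m_assoc[of x "inv\<^bsub>G\<^esub> x" y])
  then have yx': "y \<otimes>\<^bsub>G\<^esub> inv\<^bsub>G\<^esub> x = x \<otimes>\<^bsub>G\<^esub> y" by (simp add: inv_solve_right')
  have yxk: "y \<otimes>\<^bsub>G\<^esub> x [^]\<^bsub>G\<^esub> k = x [^]\<^bsub>G\<^esub> (- k) \<otimes>\<^bsub>G\<^esub> y" for k :: int
  proof (induction k rule: int_induct[where k = 0])
    case (step1 i)
    have "y \<otimes>\<^bsub>G\<^esub> x [^]\<^bsub>G\<^esub> (i + 1) = (y \<otimes>\<^bsub>G\<^esub> x [^]\<^bsub>G\<^esub> i) \<otimes>\<^bsub>G\<^esub> x"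
      by (simp add: int_pow_mult m_assoc)
    also have "\<dots> = x [^]\<^bsub>G\<^esub> (- i) \<otimes>\<^bsub>G\<^esub> inv\<^bsub>G\<^esub> x \<otimes>\<^bsub>G\<^esub> y"
      unfolding step1(2) by (simp add: m_assoc yx)
    also have "x [^]\<^bsub>G\<^esub> (- i) \<otimes>\<^bsub>G\<^esub> inv\<^bsub>G\<^esub> x = x [^]\<^bsub>G\<^esub> (- (i + 1))"
      using int_pow_mult[of x "- i" "- 1"] by (simp add: int_pow_neg)
    finally show ?case .
  next
    case (step2 i)
    have "y \<otimes>\<^bsub>G\<^esub> x [^]\<^bsub>G\<^esub> (i - 1) = (y \<otimes>\<^bsub>G\<^esub> x [^]\<^bsub>G\<^esub> i) \<otimes>\<^bsub>G\<^esub> inv\<^bsub>G\<^esub> x"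
      using int_pow_mult[of x i "- 1"] by (simp add: int_pow_neg m_assoc)
    also have "\<dots> = x [^]\<^bsub>G\<^esub> (- i) \<otimes>\<^bsub>G\<^esub> x \<otimes>\<^bsub>G\<^esub> y"
      unfolding step2(2) by (simp add: m_assoc yx')
    also have "x [^]\<^bsub>G\<^esub> (- i) \<otimes>\<^bsub>G\<^esub> x = x [^]\<^bsub>G\<^esub> (- (i - 1))"
      using int_pow_mult[of x "- i" 1] by simp
    finally show ?case .
  qed simp
  define e where "e i s = (if s then x [^]\<^bsub>G\<^esub> i \<otimes>\<^bsub>G\<^esub> y else x [^]\<^bsub>G\<^esub> i)" for i :: int and s
  have e_mult: "e i s \<otimes>\<^bsub>G\<^esub> e j t =
      e (i + (if s then - j else j) + (if s \<and> t then m else 0)) (s \<noteq> t)" for i j s t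
  proof -
    have "(x [^]\<^bsub>G\<^esub> i \<otimes>\<^bsub>G\<^esub> y) \<otimes>\<^bsub>G\<^esub> x [^]\<^bsub>G\<^esub> j = x [^]\<^bsub>G\<^esub> (i - j) \<otimes>\<^bsub>G\<^esub> y"
      using int_pow_mult[of x i "- j"] by (simp add: m_assoc yxk)
    moreover from this have "(x [^]\<^bsub>G\<^esub> i \<otimes>\<^bsub>G\<^esub> y) \<otimes>\<^bsub>G\<^esub> (x [^]\<^bsub>G\<^esub> j \<otimes>\<^bsub>G\<^esub> y) = x [^]\<^bsub>G\<^esub> (i - j + m)"
      by (simp add: m_assoc[symmetric]) (simp add: m_assoc yy int_pow_mult)
    ultimately show ?thesis by (cases s; cases t) (simp_all add: e_def int_pow_mult m_assoc)
  qed
  have e_car: "e i s \<in> carrier G" for i s by (simp add: e_def)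
  have e_one: "e 0 False = \<one>\<^bsub>G\<^esub>" by (simp add: e_def)
  have cl_e: "cl w \<in> range (\<lambda>(i, s). e i s)" for w
  proof (induction w)
    case Nil
    then show ?case using e_one by (force simp: one)
  next
    case (Cons l w)
    then obtain j t where w: "cl w = e j t" by auto
    have l: "cl [l] \<in> range (\<lambda>(i, s). e i s)"
    proof (cases l rule: prod.exhaust)
      case (Pair g b)
      have i: "cl (gen_pow g k) \<in> range (\<lambda>(i, s). e i s)" if "g = X" for k
        using that by (auto simp: gp e_def intro!: range_eqI[of _ _ "(k, False)"])
      show ?thesis
      proof (cases g)
        case gX: X
        then show ?thesis using i[of 1] i[of "- 1"] Pair by (cases b) (simp_all add: gen_pow_def)
      next
        case gY: Y
        have "e (- m) True \<otimes>\<^bsub>G\<^esub> e 0 True = \<one>\<^bsub>G\<^esub>" by (simp add: e_mult e_one)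
        then have "inv\<^bsub>G\<^esub> y = e (- m) True"
          using e_car[of "- m" True] by (intro inv_equality) (simp_all add: e_def)
        moreover have "cl [(Y, False)] = inv\<^bsub>G\<^esub> y"
          using gp(2)[of "- 1"] by (simp add: gen_pow_def int_pow_neg)
        moreover have "cl [(Y, True)] = e 0 True" by (simp add: e_def y_def[symmetric])
        ultimately show ?thesis unfolding Pair gY by (cases b) auto
      qed
    qed
    then obtain i s where "cl [l] = e i s" by auto
    then have "cl (l # w) = e i s \<otimes>\<^bsub>G\<^esub> e j t" using mult[of "[l]" w] w by simp
    then show ?case unfolding e_mult by auto
  qed
  have carrier_e: "carrier G = range (\<lambda>(i, s). e i s)"
    using cl_e e_car by (auto simp: car)
  have x_eq: "x [^]\<^bsub>G\<^esub> i = x [^]\<^bsub>G\<^esub> j" if "int n dvd i - j" for i j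
  proof -
    have "int (ord x) dvd int n" using xn by (simp add: int_pow_eq_id)
    then have "int (ord x) dvd j - i" using that by (metis dvd_diff_commute dvd_trans)
    then show ?thesis by (simp add: int_pow_eq)
  qed
  have e_mod: "e (i mod int n) s = e i s" for i s
    using x_eq[of "i mod int n" i] by (simp add: e_def mod_eq_dvd_iff[symmetric])
  let ?D = "{0..<int n} \<times> (UNIV :: bool set)"
  have img: "(\<lambda>(i, s). e i s) ` ?D = carrier G"
  proof
    show "carrier G \<subseteq> (\<lambda>(i, s). e i s) ` ?D"
    proof
      fix z assume "z \<in> carrier G"
      then obtain i s where "z = e (i mod int n) s" by (auto simp: carrier_e e_mod)
      then show "z \<in> (\<lambda>(i, s). e i s) ` ?D" using n by force
    qed
  qed (auto simp: e_car)
  have "card ((\<lambda>(i, s). e i s) ` ?D) = card ?D"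
    unfolding img using ord by (simp add: order_def G_def card_cartesian_product)
  then have inj: "inj_on (\<lambda>(i, s). e i s) ?D" by (intro eq_card_imp_inj_on) simp
  have "e i s = e j t \<longleftrightarrow> s = t \<and> int n dvd i - j" for i j s t
  proof
    assume "e i s = e j t"
    then have "e (i mod int n) s = e (j mod int n) t" by (simp add: e_mod)
    then have "(i mod int n, s) = (j mod int n, t)"
      using inj_onD[OF inj, of "(i mod int n, s)" "(j mod int n, t)"] n by simp
    then show "s = t \<and> int n dvd i - j" by (simp add: mod_eq_dvd_iff)
  next
    assume "s = t \<and> int n dvd i - j"
    then show "e i s = e j t" using x_eq by (simp add: e_def)
  qed
  then have "H_normal_form G n m e"
    using n order_H_iff[of n m] ord carrier_e e_mult by unfold_locales simp_all
  then show ?thesis unfolding G_def by blast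
qed


theorem mainTheorem1:
  fixes n :: nat and m :: int
  assumes "n \<ge> 2"
    and "order (H n m) = 2 * n"
  shows "(odd n \<longrightarrow> harborth (H n m) = 2 * n + 1) \<and>
         (n mod 4 = 0 \<and> odd m \<longrightarrow> harborth (H n m) = 2 * n) \<and>
         (n mod 4 = 2 \<and> odd m \<longrightarrow> harborth (H n m) = 2 * n + 1) \<and>
         (even n \<and> n \<noteq> 2 \<and> even m \<longrightarrow> harborth (H n m) = n + 2) \<and>
         (n = 2 \<and> even m \<longrightarrow> harborth (H n m) = 5)"
proof -
  obtain e where "H_normal_form (H n m) n m e" using H_has_normal_form[OF assms] by blast
  then interpret H_normal_form "H n m" n m e .
  show ?thesis
  proof (intro conjI impI)
    assume "odd n"
    then show "harborth (H n m) = 2 * n + 1" using harborth_full[OF group_exp_odd] by blast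
  next
    assume *: "n mod 4 = 0 \<and> odd m"
    \<comment> \<open>Since \<open>n\<close> divides \<open>2 * m\<close>, a multiple of 4 as
      \<open>n\<close> contradicts odd \<open>m\<close>.\<close>
    then have "4 dvd int n" by presburger
    then have "4 dvd 2 * m" using n_dvd by (rule dvd_trans)
    then have False using * by presburger
    then show "harborth (H n m) = 2 * n" ..
  next
    assume "n mod 4 = 2 \<and> odd m"
    then show "harborth (H n m) = 2 * n + 1" using harborth_full[OF group_exp_odd_m] by blast
  next
    assume "even n \<and> n \<noteq> 2 \<and> even m"
    then show "harborth (H n m) = n + 2" using harborth_even by blast
  next
    assume "n = 2 \<and> even m"
    then show "harborth (H n m) = 5" using harborth_klein by blast
  qed
qed

end
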